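(* Let $k$ be an integer with $4 \le k \le 1000$ such that $4$ exactly divides $k$ (i.e. $4\mid k$ and $8\nmid k$) and $2k-1$ is a prime power. Then the only solution of the equation $x^2+(2k-1)^y=k^z$ in positive integers $x,y,z$ is $(x,y,z)=(k-1,1,2)$. *)

theory Defs
  imports "HOL-Number_Theory.Number_Theory"
begin

end

(*
  Put q = 2k - 1, so that q = 7 (mod 16). Reduction modulo 8 shows that y is odd. If k^z = a^2 is
  a square, then a - x and a + x are coprime divisors of a power of a prime, so a - x = 1 and
  2a = q^y + 1 = 8 (mod 16); hence a is not divisible by 8, which forces z = 2 and y = 1.
  This settles even z, and also odd z when k is a square.

  For each of the 36 remaining k there is a local obstruction for odd y and z. Modulo an odd r
  for which k and q are powers of h, the equation makes h^t - q a square, where t is linear in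
  the exponents, and this excludes about half of the residues t. Finitely
  many moduli r exclude all pairs (y, z); the pairs are enumerated digit by digit in a mixed
  radix, and a branch is closed as soon as one modulus whose t is already determined excludes it.
*)

theory Submission
  imports Defs
begin

section \<open>Modular arithmetic on bit lists\<close>

text \<open>The pair y = 1, z = 2 does solve the equation and hence survives modulo every
  \<open>r\<close>. Odd z can be refuted only because some moduli see the parity of z: if k had odd
  order modulo each of them, some odd z would agree with 2 modulo all these orders.

  With y = 2Y + 1 and z = 2Z + 1 the exponent is t = \<kappa> + 2\<kappa>Z + 2\<nu>Y modulo a period
  of \<open>h\<close>. All periods in use have prime factors at most 11, so few digits of Y and Z
  determine many of the values t. Closing branches early is essential: for k = 516 the radices
  multiply to 95040, which would mean about 9 * 10^9 pairs.

  The certificates are not trusted. Each of their congruences is recomputed, and an entry that fails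
  yields a sieve that admits everything.\<close>

text \<open>The computations below are carried out by rewriting. All functions are first-order and
  avoid conditional expressions, because the simplifier would traverse their normalized
  arguments again.\<close>

fun val :: "bool list \<Rightarrow> nat" where
  "val [] = 0"
| "val (b # bs) = of_bool b + 2 * val bs"

fun add :: "bool \<Rightarrow> bool list \<Rightarrow> bool list \<Rightarrow> bool list" where
  "add c (False # xs) (False # ys) = c # add False xs ys"
| "add False (True # xs) (False # ys) = True # add False xs ys"
| "add False (False # xs) (True # ys) = True # add False xs ys"
| "add False (True # xs) (True # ys) = False # add True xs ys"
| "add True (True # xs) (False # ys) = False # add True xs ys"
| "add True (False # xs) (True # ys) = False # add True xs ys"
| "add True (True # xs) (True # ys) = True # add True xs ys"
| "add c [] ys = []"
| "add c (x # xs) [] = []"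

fun top_bit :: "bool list \<Rightarrow> bool" where
  "top_bit [] = False"
| "top_bit [b] = b"
| "top_bit (a # b # bs) = top_bit (b # bs)"

fun inc :: "bool list \<Rightarrow> bool list" where
  "inc [] = []"
| "inc (False # bs) = True # bs"
| "inc (True # bs) = False # inc bs"

fun cond :: "bool \<Rightarrow> 'a \<Rightarrow> 'a \<Rightarrow> 'a" where
  "cond True a b = a"
| "cond False a b = b"

text \<open>\<open>t\<close> is to be \<open>s\<close> minus the modulus at fixed width; a set top
  bit means that the difference is negative. As a function of its own it receives \<open>t\<close>
  normalized, before \<open>t\<close> is both tested and returned.\<close>

definition reduce :: "bool list \<Rightarrow> bool list \<Rightarrow> bool list" where
  "reduce s t = cond (top_bit t) s t"

definition sub_if_ge :: "bool list \<Rightarrow> bool list \<Rightarrow> bool list" where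
  "sub_if_ge N s = reduce s (add False s N)"

definition madd :: "bool list \<Rightarrow> bool list \<Rightarrow> bool list \<Rightarrow> bool list" where
  "madd N a b = sub_if_ge N (add False a b)"

text \<open>A modulus is given by its two's complement with one spare leading bit, so that the sign of
  a difference can be read off its top bit.\<close>

definition modulus :: "nat \<Rightarrow> bool list \<Rightarrow> bool" where
  "modulus m N \<longleftrightarrow> 0 < m \<and> 2 * m \<le> 2 ^ length N \<and> val N = 2 ^ length N - m"

text \<open>Residues are kept reduced and at one width, so that congruence is equality of bit lists
  and a set of residues can be stored as a trie.\<close>

definition rep :: "nat \<Rightarrow> bool list \<Rightarrow> bool list \<Rightarrow> nat \<Rightarrow> bool" where
  "rep m N a x \<longleftrightarrow> length a = length N \<and> val a = x mod m"

lemma val_less: "val bs < 2 ^ length bs"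
  by (induction bs) auto

lemma length_add: "length xs = length ys \<Longrightarrow> length (add c xs ys) = length xs"
  by (induction c xs ys rule: add.induct) auto

lemma digit_mod: "of_bool b + 2 * (a mod n) = (of_bool b + 2 * a) mod (2 * n)" for a :: nat
  using mod_mult2_eq[of "of_bool b + 2 * a" 2 n] by (cases b) auto

lemma val_add:
  "length xs = length ys \<Longrightarrow>
   val (add c xs ys) = (of_bool c + val xs + val ys) mod 2 ^ length xs"
proof (induction c xs ys rule: add.induct)
  case (1 c xs ys)
  then show ?case
    using digit_mod[of c "val xs + val ys" "2 ^ length xs"] by (simp add: distrib_left)
next
  case (2 xs ys)
  then show ?case
    using digit_mod[of True "val xs + val ys" "2 ^ length xs"] by (simp add: distrib_left)
next
  case (3 xs ys)
  then show ?case
    using digit_mod[of True "val xs + val ys" "2 ^ length xs"] by (simp add: distrib_left)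
next
  case (4 xs ys)
  then show ?case
    using digit_mod[of False "1 + val xs + val ys" "2 ^ length xs"] by (simp add: distrib_left)
next
  case (5 xs ys)
  then show ?case
    using digit_mod[of False "1 + val xs + val ys" "2 ^ length xs"] by (simp add: distrib_left)
next
  case (6 xs ys)
  then show ?case
    using digit_mod[of False "1 + val xs + val ys" "2 ^ length xs"] by (simp add: distrib_left)
next
  case (7 xs ys)
  then show ?case
    using digit_mod[of True "1 + val xs + val ys" "2 ^ length xs"] by (simp add: distrib_left)
qed auto

lemma top_bit_iff: "bs \<noteq> [] \<Longrightarrow> top_bit bs \<longleftrightarrow> 2 ^ (length bs - 1) \<le> val bs"
proof (induction bs rule: top_bit.induct)
  case (3 a b bs)
  then show ?case by (auto simp: of_bool_def)
qed (auto)

lemma length_inc [simp]: "length (inc bs) = length bs"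
  by (induction bs rule: inc.induct) auto

lemma val_inc: "val bs + 1 < 2 ^ length bs \<Longrightarrow> val (inc bs) = val bs + 1"
  by (induction bs rule: inc.induct) auto

text \<open>The spare bit does two things: the sum, being below 2m \<le> 2^w, cannot overflow, and
  the difference with m, taken modulo 2^w, lies below 2^(w-1) exactly when it is not
  negative.\<close>

lemma rep_madd:
  assumes m: "modulus m N" and "rep m N a x" "rep m N b y"
  shows "rep m N (madd N a b) (x + y)"
proof -
  define w where "w = length N"
  define s where "s = add False a b"
  define t where "t = add False s N"
  have m': "0 < m" "2 * m \<le> 2 ^ w" "val N = 2 ^ w - m"
    using m by (auto simp: modulus_def w_def)
  have la: "length a = w" "length b = w" and va: "val a = x mod m" "val b = y mod m"
    using assms by (auto simp: rep_def w_def)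
  have lt: "val a < m" "val b < m" using va m' by auto
  have ls: "length s = w" by (simp add: s_def length_add la)
  have lt': "length t = w" by (simp add: t_def length_add ls w_def)
  have vs: "val s = val a + val b"
    using lt m' by (simp add: s_def val_add la)
  have w0: "w > 0" using m' by (cases w) auto
  have vt: "val t = (val s + 2 ^ w - m) mod 2 ^ w"
    using m' ls by (simp add: t_def val_add w_def)
  have tb: "top_bit t \<longleftrightarrow> 2 ^ (w - 1) \<le> val t"
    using top_bit_iff[of t] lt' w0 by fastforce
  have w2: "2 ^ w = 2 * (2::nat) ^ (w - 1)" using w0 by (cases w) auto
  have md: "(x + y) mod m = (val a + val b) mod m"
    by (simp add: va mod_add_eq)
  show ?thesis
  proof (cases "val s < m")
    case True
    then have "val t = val s + 2 ^ w - m" using vt m' by simp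
    then have "top_bit t" using tb w2 m' True by simp
    then show ?thesis using True vs md ls
      by (simp add: madd_def sub_if_ge_def reduce_def s_def[symmetric] t_def[symmetric] rep_def w_def)
  next
    case False
    then have "val s + 2 ^ w - m = 2 ^ w + (val s - m)" by simp
    moreover have "(2 ^ w + (val s - m)) mod 2 ^ w = val s - m" using lt vs m' by simp
    ultimately have v: "val t = val s - m" using vt by metis
    then have "\<not> top_bit t" using tb w2 m' lt vs by simp
    moreover have "(val a + val b) mod m = val s - m"
      using False lt vs by (simp add: mod_if)
    ultimately show ?thesis using v md lt'
      by (simp add: madd_def sub_if_ge_def reduce_def s_def[symmetric] t_def[symmetric] rep_def w_def)
  qed
qed

lemma rep_cong: "rep m N a x \<Longrightarrow> [x = y] (mod m) \<Longrightarrow> rep m N a y"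
  by (auto simp: rep_def cong_def)

lemma val_inj: "length xs = length ys \<Longrightarrow> val xs = val ys \<Longrightarrow> xs = ys"
proof (induction xs ys rule: list_induct2)
  case (Cons x xs y ys)
  have "of_bool x + 2 * a = of_bool y + 2 * b \<Longrightarrow> x = y \<and> a = b" for a b :: nat
    by (cases x; cases y; simp; presburger)
  moreover have "of_bool x + 2 * val xs = of_bool y + 2 * val ys" using Cons.prems by simp
  ultimately have "x = y" "val xs = val ys" by blast+
  then show ?case by (simp only: Cons.IH)
qed auto

lemma rep_unique: "rep m N a x \<Longrightarrow> rep m N b y \<Longrightarrow> [x = y] (mod m) \<longleftrightarrow> a = b"
  by (auto simp: rep_def cong_def intro: val_inj)

fun zeros :: "bool list \<Rightarrow> bool list" where
  "zeros [] = []"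
| "zeros (b # bs) = False # zeros bs"

lemma rep_zeros: "rep m N (zeros N) 0"
proof -
  have "length (zeros N) = length N" "val (zeros N) = 0" by (induction N) auto
  then show ?thesis by (simp add: rep_def)
qed

definition one :: "bool list \<Rightarrow> bool list" where "one N = inc (zeros N)"

lemma rep_one:
  assumes "modulus m N" "m > 1" shows "rep m N (one N) 1"
proof -
  have z: "length (zeros N) = length N" "val (zeros N) = 0" by (induction N) auto
  have "val (inc (zeros N)) = 1" using val_inc[of "zeros N"] z assms by (auto simp: modulus_def)
  then show ?thesis using z assms by (simp add: rep_def one_def)
qed

fun times :: "bool list \<Rightarrow> nat \<Rightarrow> bool list \<Rightarrow> bool list" where
  "times N 0 c = zeros N"
| "times N (Suc 0) c = c"
| "times N (Suc (Suc n)) c = madd N c (times N (Suc n) c)"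

lemma rep_times: "modulus m N \<Longrightarrow> rep m N c x \<Longrightarrow> rep m N (times N n c) (n * x)"
proof (induction N n c rule: times.induct)
  case (1 N c)
  then show ?case by (simp add: rep_zeros)
next
  case (3 N n c)
  then show ?case using rep_madd[of m N c x] by simp
qed auto

definition double :: "bool list \<Rightarrow> bool list \<Rightarrow> bool list" where "double N c = madd N c c"

fun residue :: "bool list \<Rightarrow> num \<Rightarrow> bool list" where
  "residue N num.One = one N"
| "residue N (num.Bit0 n) = double N (residue N n)"
| "residue N (num.Bit1 n) = madd N (one N) (double N (residue N n))"

lemma rep_residue:
  assumes "modulus m N" "m > 1"
  shows "rep m N (residue N n) (numeral n)"
proof (induction n)
  case One
  then show ?case using rep_one[OF assms] by simp
next
  case (Bit0 n)
  have "rep m N (residue N (num.Bit0 n)) (numeral n + numeral n)"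
    using rep_madd[OF assms(1) Bit0 Bit0] by (simp add: double_def)
  then show ?case by (simp add: numeral_Bit0)
next
  case (Bit1 n)
  have "rep m N (residue N (num.Bit1 n)) (1 + (numeral n + numeral n))"
    using rep_madd[OF assms(1) rep_one[OF assms] rep_madd[OF assms(1) Bit1 Bit1]] by (simp add: double_def)
  then show ?case by (simp add: numeral_Bit1 add.assoc add.commute)
qed

text \<open>The leading digit is preceded by a zero, so that twice the number still fits the width.\<close>

fun neg_bits :: "num \<Rightarrow> bool list" where
  "neg_bits num.One = [False, True]"
| "neg_bits (num.Bit0 n) = True # neg_bits n"
| "neg_bits (num.Bit1 n) = False # neg_bits n"

text \<open>\<open>neg_bits\<close> is the one's complement, which \<open>inc\<close> later turns
  into 2^w - n. The slack + 2 in the bound keeps the induction linear: for \<open>num.Bit1\<close>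
  the left side is 2(2n + 1) + 2 = 2(2n + 2).\<close>

lemma neg_bits: "val (neg_bits n) + numeral n + 1 = 2 ^ length (neg_bits n) \<and>
    2 * numeral n + 2 \<le> (2::nat) ^ length (neg_bits n)"
proof (induction n)
  case (Bit0 n)
  have "numeral (num.Bit0 n) = 2 * (numeral n :: nat)" by (simp only: numeral_Bit0[of n] mult_2)
  then show ?case
    using Bit0 unfolding neg_bits.simps val.simps length_Cons power_Suc of_bool_eq by linarith
next
  case (Bit1 n)
  have "numeral (num.Bit1 n) = 2 * (numeral n :: nat) + 1" by (simp only: numeral_Bit1[of n] mult_2)
  then show ?case
    using Bit1 unfolding neg_bits.simps val.simps length_Cons power_Suc of_bool_eq by linarith
qed simp

lemma modulus_neg_bits: "modulus (numeral n) (inc (neg_bits n))"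
proof -
  have n: "(numeral n :: nat) > 0" by simp
  have "val (inc (neg_bits n)) = val (neg_bits n) + 1"
    using neg_bits[of n] n by (intro val_inc) linarith
  then show ?thesis using neg_bits[of n] n unfolding modulus_def length_inc by linarith
qed

section \<open>Sets of residues and of exponents as binary tries\<close>

text \<open>Only monotonicity of \<open>put\<close> is used: a trie that contains too much weakens the sieve but
  does not invalidate it, and \<open>Full\<close> serves as the answer to a malformed certificate.\<close>

datatype trie = Empty | Full | Node trie trie

fun look :: "trie \<Rightarrow> bool list \<Rightarrow> bool" where
  "look Empty bs = False"
| "look Full bs = True"
| "look (Node l r) [] = False"
| "look (Node l r) (False # bs) = look l bs"
| "look (Node l r) (True # bs) = look r bs"

fun put :: "trie \<Rightarrow> bool list \<Rightarrow> trie" where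
  "put Full bs = Full"
| "put t [] = Full"
| "put Empty (False # bs) = Node (put Empty bs) Empty"
| "put Empty (True # bs) = Node Empty (put Empty bs)"
| "put (Node l r) (False # bs) = Node (put l bs) r"
| "put (Node l r) (True # bs) = Node l (put r bs)"

lemma look_put_same: "look (put t bs) bs"
  by (induction t bs rule: put.induct) auto

lemma look_put: "look t cs \<Longrightarrow> look (put t bs) cs"
proof (induction t bs arbitrary: cs rule: put.induct)
  case (5 l r bs)
  then show ?case by (cases "(Node l r, cs)" rule: look.cases) auto
next
  case (6 l r bs)
  then show ?case by (cases "(Node l r, cs)" rule: look.cases) auto
qed auto

text \<open>Consecutive squares differ by the odd numbers \<open>d\<close>, so no multiplication
  occurs.\<close>

fun shifted_squares :: "bool list \<Rightarrow> bool list \<Rightarrow> bool list \<Rightarrow> nat \<Rightarrow> trie \<Rightarrow> trie" where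
  "shifted_squares N s d 0 t = t"
| "shifted_squares N s d (Suc n) t =
     shifted_squares N (madd N s d) (inc (inc d)) n (put t s)"

lemma look_shifted_squares_mono: "look t c \<Longrightarrow> look (shifted_squares N s d n t) c"
  by (induction n arbitrary: s d t) (auto intro: look_put)

text \<open>The bound \<open>2 * (x + n) \<le> m + 1\<close> keeps every odd step still to be added
  below \<open>m\<close>, so \<open>d\<close> needs no reduction. From x = 0 it allows (m + 1)/2
  terms, enough for all squares modulo an odd \<open>m\<close>.\<close>

lemma look_shifted_squares:
  assumes m: "modulus m N"
    and "rep m N s (x\<^sup>2 + q)" "length d = length N" "val d = 2 * x + 1" "2 * (x + n) \<le> m + 1"
    and "i < n" "rep m N c ((x + i)\<^sup>2 + q)"
  shows "look (shifted_squares N s d n t) c"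
  using assms(2-)
proof (induction n arbitrary: s d t x i)
  case (Suc n)
  show ?case
  proof (cases i)
    case 0
    then have "s = c" using rep_unique Suc.prems(1,6) by (metis add_0_right cong_refl)
    then show ?thesis by (simp add: look_shifted_squares_mono look_put_same)
  next
    case (Suc i')
    have small: "2 * x + 1 < m" "2 * m \<le> 2 ^ length N"
      using Suc Suc.prems m by (auto simp: modulus_def)
    have "(x + 1)\<^sup>2 + q = x\<^sup>2 + q + (2 * x + 1)" by (simp add: power2_eq_square)
    moreover have "rep m N d (2 * x + 1)" using Suc.prems small by (simp add: rep_def)
    ultimately have s: "rep m N (madd N s d) ((x + 1)\<^sup>2 + q)"
      using rep_madd[OF m Suc.prems(1)] by metis
    have "val (inc d) = val d + 1" using Suc.prems small by (intro val_inc) simp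
    moreover have "val (inc (inc d)) = val (inc d) + 1"
      using Suc.prems small calculation by (intro val_inc) simp
    ultimately have d: "val (inc (inc d)) = 2 * (x + 1) + 1" using Suc.prems by simp
    show ?thesis using Suc.IH[OF s _ d, of i'] Suc Suc.prems by simp
  qed
qed simp

fun mult :: "bool list \<Rightarrow> num \<Rightarrow> bool list \<Rightarrow> bool list" where
  "mult N num.One c = c"
| "mult N (num.Bit0 n) c = double N (mult N n c)"
| "mult N (num.Bit1 n) c = madd N c (double N (mult N n c))"

lemma rep_mult:
  assumes "modulus m N" "rep m N c x"
  shows "rep m N (mult N n c) (numeral n * x)"
proof (induction n)
  case One
  then show ?case using assms by simp
next
  case (Bit0 n)
  then show ?case
    using rep_madd[OF assms(1) Bit0 Bit0] by (simp only: mult.simps double_def numeral_Bit0[of n] distrib_right)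
next
  case (Bit1 n)
  then show ?case
    using rep_madd[OF assms rep_madd[OF assms(1) Bit1 Bit1]]
    by (simp only: mult.simps double_def numeral_Bit1[of n] distrib_right mult_1 add.commute)
qed

text \<open>The list has one entry more than its length parameter: when that parameter is the
  period, the last entry is the power to be compared with 1.\<close>

fun powers :: "bool list \<Rightarrow> num \<Rightarrow> bool list \<Rightarrow> nat \<Rightarrow> bool list list" where
  "powers N h c 0 = [c]"
| "powers N h c (Suc n) = c # powers N h (mult N h c) n"

lemma length_powers [simp]: "length (powers N h c n) = Suc n"
  by (induction n arbitrary: c) auto

lemma rep_powers:
  assumes "modulus m N" "rep m N c x" "i \<le> n"
  shows "rep m N (powers N h c n ! i) (numeral h ^ i * x)"
  using assms(2,3)
proof (induction n arbitrary: c x i)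
  case (Suc n)
  show ?case
  proof (cases i)
    case (Suc j)
    then show ?thesis
      using Suc.IH[OF rep_mult[OF assms(1) Suc.prems(1)], of j h] Suc.prems
      by (simp add: mult.assoc mult.left_commute)
  qed (use Suc in auto)
qed auto

fun put_if :: "bool \<Rightarrow> trie \<Rightarrow> bool list \<Rightarrow> trie" where
  "put_if True t b = put t b"
| "put_if False t b = t"

text \<open>Turns a set of residues into a set of exponents: \<open>e\<close> counts along the
  powers of \<open>h\<close>, and what is collected are the t for which h^t - q is a square.\<close>

fun select :: "trie \<Rightarrow> bool list list \<Rightarrow> bool list \<Rightarrow> trie \<Rightarrow> trie" where
  "select sq [] e t = t"
| "select sq (c # cs) e t = select sq cs (inc e) (put_if (look sq c) t e)"

lemma look_put_if: "look t c \<Longrightarrow> look (put_if b t a) c"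
  by (cases b) (auto intro: look_put)

lemma look_select_mono: "look t c \<Longrightarrow> look (select sq cs e t) c"
  by (induction cs arbitrary: e t) (auto intro: look_put_if)

lemma look_select:
  assumes "i < length cs" "look sq (cs ! i)" "length e = length a"
    "val e + i = val a"
  shows "look (select sq cs e t) a"
  using assms
proof (induction cs arbitrary: i e t)
  case (Cons c cs)
  show ?case
  proof (cases i)
    case 0
    then have "e = a" using Cons.prems val_inj by auto
    then show ?thesis using Cons.prems 0 by (simp add: look_select_mono look_put_same)
  next
    case (Suc j)
    have "val e + 1 < 2 ^ length e"
      using Cons.prems Suc val_less[of a] by simp
    then have "val (inc e) = val e + 1" by (rule val_inc)
    then show ?thesis using Cons.IH[of j "inc e"] Cons.prems Suc by simp
  qed
qed simp


section \<open>Sieving pairs of exponents\<close>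

text \<open>\<open>Sieve N F t st\<close> consists of a modulus for \<open>t\<close>, the set \<open>F\<close> of admissible \<open>t\<close>, the
  contribution to \<open>t\<close> of the digits chosen so far, and for each further pair of digits of
  \<open>Y\<close> and \<open>Z\<close> its possible contributions.\<close>

datatype sieve = Sieve "bool list" trie "bool list" "(bool list list \<times> bool list list) list"

fun multiples :: "bool list \<Rightarrow> nat \<Rightarrow> bool list \<Rightarrow> bool list \<Rightarrow> bool list list" where
  "multiples N 0 a u = []"
| "multiples N (Suc n) a u = a # multiples N n (madd N a u) u"

lemma rep_multiples:
  assumes "modulus m N" "rep m N u y" "rep m N a x" "i < n"
  shows "rep m N (multiples N n a u ! i) (x + i * y)"
  using assms(3,4)
proof (induction n arbitrary: a x i)
  case (Suc n)
  show ?case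
  proof (cases i)
    case (Suc j)
    then show ?thesis
      using Suc.IH[OF rep_madd[OF assms(1) Suc.prems(1) assms(2)], of j] Suc.prems
      by (simp add: add.assoc)
  qed (use Suc in auto)
qed simp

text \<open>Digits come least significant first, so passing a digit of radix \<open>l\<close>
  multiplies both weights by \<open>l\<close>. \<open>u\<close> is the weight of Z and
  \<open>v\<close> that of Y, although each pair lists the Y contributions first.\<close>

fun shifts :: "bool list \<Rightarrow> bool list \<Rightarrow> bool list \<Rightarrow> nat list \<Rightarrow> (bool list list \<times> bool list list) list" where
  "shifts N u v [] = []"
| "shifts N u v (l # ls) =
     (multiples N l (zeros N) v, multiples N l (zeros N) u) # shifts N (times N l u) (times N l v) ls"

text \<open>The weight left for the quotients once all digits are read. If it vanishes modulo the
  period, t no longer depends on them.\<close>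

fun final :: "bool list \<Rightarrow> nat list \<Rightarrow> bool list \<Rightarrow> bool list" where
  "final N [] u = u"
| "final N (l # ls) u = final N ls (times N l u)"

text \<open>The meaning of a sieve for one given pair, used as the invariant of the proofs; the
  evaluation runs on \<open>sieved\<close>.\<close>

fun passes :: "nat list \<Rightarrow> nat \<Rightarrow> nat \<Rightarrow> sieve \<Rightarrow> bool" where
  "passes [] Y Z (Sieve N F t st) = look F t"
| "passes (l # ls) Y Z (Sieve N F t st) = (\<exists>A B st'. st = (A, B) # st' \<and>
     passes ls (Y div l) (Z div l) (Sieve N F (madd N (madd N t (A ! (Y mod l))) (B ! (Z mod l))) st'))"

text \<open>Writing Y = Y mod l + l (Y div l), and Z likewise, peels off one digit at a time; the
  vanishing final weights dispose of the last quotients.\<close>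

lemma passes_Sieve:
  assumes "modulus m N" "\<forall>l\<in>set ls. l > 0"
    and "rep m N t x" "rep m N u a" "rep m N v b"
    and "final N ls u = zeros N" "final N ls v = zeros N"
    and "\<And>c. rep m N c (x + a * Z + b * Y) \<Longrightarrow> look F c"
  shows "passes ls Y Z (Sieve N F t (shifts N u v ls))"
  using assms(2-)
proof (induction ls arbitrary: t x u a v b Y Z)
  case Nil
  have "[a = 0] (mod m)" "[b = 0] (mod m)"
    using Nil rep_unique rep_zeros by (metis final.simps(1))+
  then have "[a * Z + b * Y = 0 * Z + 0 * Y] (mod m)" by (intro cong_add cong_mult cong_refl)
  then have "[0 = a * Z + b * Y] (mod m)" by (simp add: cong_sym)
  from cong_add[OF cong_refl this, of x] have "[x = x + a * Z + b * Y] (mod m)"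
    by (simp add: add.assoc)
  then have "rep m N t (x + a * Z + b * Y)" using Nil rep_cong by blast
  then show ?case using Nil by simp
next
  case (Cons l ls)
  have l: "l > 0" using Cons.prems by simp
  have A: "rep m N (multiples N l (zeros N) v ! (Y mod l)) (Y mod l * b)"
    using rep_multiples[OF assms(1) Cons.prems(4) rep_zeros, of "Y mod l" l] l by simp
  have B: "rep m N (multiples N l (zeros N) u ! (Z mod l)) (Z mod l * a)"
    using rep_multiples[OF assms(1) Cons.prems(3) rep_zeros, of "Z mod l" l] l by simp
  have t: "rep m N (madd N (madd N t (multiples N l (zeros N) v ! (Y mod l)))
      (multiples N l (zeros N) u ! (Z mod l))) (x + Y mod l * b + Z mod l * a)" (is "rep m N ?t ?x")
    by (intro rep_madd assms(1) Cons.prems A B)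
  have "Y mod l * b + l * b * (Y div l) = b * Y" "Z mod l * a + l * a * (Z div l) = a * Z"
    by (metis distrib_left mod_mult_div_eq mult.assoc mult.commute)+
  then have eq: "?x + l * a * (Z div l) + l * b * (Y div l) = x + a * Z + b * Y" by linarith
  have "passes ls (Y div l) (Z div l) (Sieve N F ?t (shifts N (times N l u) (times N l v) ls))"
  proof (rule Cons.IH[OF _ t rep_times[OF assms(1) Cons.prems(3)] rep_times[OF assms(1) Cons.prems(4)]])
    show "look F c" if "rep m N c (?x + l * a * (Z div l) + l * b * (Y div l))" for c
      using that unfolding eq by (rule Cons.prems(7))
  qed (use Cons.prems in auto)
  then show ?case by simp
qed

text \<open>Advancing by a digit of Y and by a digit of Z are separate moves, so that the former is
  computed once for all digits of Z; the pair is dropped only by \<open>shift_z\<close>.\<close>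

fun shift_y :: "nat \<Rightarrow> sieve \<Rightarrow> sieve" where
  "shift_y i (Sieve N F t []) = Sieve N F t []"
| "shift_y i (Sieve N F t ((A, B) # st)) = Sieve N F (madd N t (A ! i)) ((A, B) # st)"

fun shift_z :: "nat \<Rightarrow> sieve \<Rightarrow> sieve" where
  "shift_z j (Sieve N F t []) = Sieve N F t []"
| "shift_z j (Sieve N F t ((A, B) # st)) = Sieve N F (madd N t (B ! j)) st"

text \<open>Group \<open>g\<close> in \<open>sieved (g # gs) ls\<close> holds the sieves that are decided by the next pair of
  digits, which has radix \<open>hd ls\<close>.\<close>

fun excluded :: "nat \<Rightarrow> sieve list \<Rightarrow> bool" where
  "excluded j [] = False"
| "excluded j (Sieve N F t [] # g) = excluded j g"
| "excluded j (Sieve N F t ((A, B) # st) # g) = (\<not> look F (madd N t (B ! j)) \<or> excluded j g)"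

text \<open>A branch still open when the groups or the radices run out counts as a failure.\<close>

fun sieved :: "sieve list list \<Rightarrow> nat list \<Rightarrow> bool" where
  "sieved [] ls = False"
| "sieved (g # gs) [] = False"
| "sieved (g # gs) (l # ls) = (\<forall>i<l. \<forall>j<l. excluded j (map (shift_y i) g) \<or>
     sieved (map (map (shift_z j)) (map (map (shift_y i)) gs)) ls)"

lemma not_excluded:
  assumes "\<forall>s\<in>set g. passes [l] Y Z s"
  shows "\<not> excluded (Z mod l) (map (shift_y (Y mod l)) g)"
  using assms
proof (induction g)
  case (Cons s g)
  then show ?case by (cases s) auto
qed simp

lemma passes_shift:
  "passes (l # ls) Y Z s \<Longrightarrow> passes ls (Y div l) (Z div l) (shift_z (Z mod l) (shift_y (Y mod l) s))"
  by (cases s) auto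

text \<open>The digits of (Y, Z) trace one path through the tree. No sieve on it excludes the pair,
  so the path never closes and the recursion ends in \<open>False\<close>. Group \<open>n\<close> is
  decided by n + 1 digits, hence \<open>take (Suc n) ls\<close>.\<close>

lemma sieved_imp_False:
  assumes "sieved gs ls" "\<forall>l\<in>set ls. l > 0"
    and "\<And>n s. n < length gs \<Longrightarrow> s \<in> set (gs ! n) \<Longrightarrow> passes (take (Suc n) ls) Y Z s"
  shows False
  using assms
proof (induction ls arbitrary: gs Y Z)
  case Nil
  then show ?case by (cases gs) auto
next
  case (Cons l ls)
  then obtain g gs' where gs: "gs = g # gs'" by (cases gs) auto
  have l: "l > 0" using Cons.prems by simp
  let ?i = "Y mod l" and ?j = "Z mod l"
  have "\<forall>s\<in>set g. passes [l] Y Z s" using Cons.prems(3)[of 0] gs by simp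
  then have "\<not> excluded ?j (map (shift_y ?i) g)" by (rule not_excluded)
  then have *: "sieved (map (map (shift_z ?j)) (map (map (shift_y ?i)) gs')) ls"
    using Cons.prems(1) mod_less_divisor[OF l] unfolding gs sieved.simps by blast
  show ?case
  proof (rule Cons.IH[OF *])
    fix n s assume n: "n < length (map (map (shift_z ?j)) (map (map (shift_y ?i)) gs'))"
      "s \<in> set (map (map (shift_z ?j)) (map (map (shift_y ?i)) gs') ! n)"
    then obtain s' where s': "s' \<in> set (gs' ! n)" "s = shift_z ?j (shift_y ?i s')" by auto
    have "passes (l # take (Suc n) ls) Y Z s'" using Cons.prems(3)[of "Suc n" s'] gs n s' by simp
    then show "passes (take (Suc n) ls) (Y div l) (Z div l) s"
      unfolding s'(2) by (rule passes_shift)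
  qed (use Cons.prems in auto)
qed

fun rev_onto :: "'a list \<Rightarrow> 'a list \<Rightarrow> 'a list" where
  "rev_onto [] ys = ys"
| "rev_onto (x # xs) ys = rev_onto xs (x # ys)"

lemma rev_onto: "rev_onto xs ys = rev xs @ ys"
  by (induction xs ys rule: rev_onto.induct) auto

fun guard :: "bool \<Rightarrow> trie \<Rightarrow> trie" where
  "guard True F = F"
| "guard False F = Full"

section \<open>Sieves from certificates\<close>

lemma passes_Full: "passes ls Y Z (Sieve N Full t (shifts N u v ls))"
  by (induction ls arbitrary: Y Z t u v) auto

lemma passes_guard:
  "passes ls Y Z (Sieve N (guard b F) t (shifts N u v ls))"
  if "b \<Longrightarrow> passes ls Y Z (Sieve N F t (shifts N u v ls))"
  using that by (cases b) (auto simp: passes_Full)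

fun is_nth :: "'a list \<Rightarrow> nat \<Rightarrow> 'a \<Rightarrow> bool" where
  "is_nth [] i x = False"
| "is_nth (y # ys) 0 x = (y = x)"
| "is_nth (y # ys) (Suc i) x = is_nth ys i x"

lemma is_nth_iff: "is_nth xs i x \<longleftrightarrow> i < length xs \<and> xs ! i = x"
  by (induction xs i x rule: is_nth.induct) auto

text \<open>In the reversed list of powers, index \<open>i\<close> holds h^(n - i). Comparing q with
  its entry \<nu> thus tests h^\<nu> q = 1 without a subtraction.\<close>

lemma is_nth_length_Suc:
  assumes "length xs = Suc n"
  shows "is_nth xs i x \<longleftrightarrow> i \<le> n \<and> xs ! i = x" "is_nth (rev xs) i x \<longleftrightarrow> i \<le> n \<and> xs ! (n - i) = x"
  using assms by (auto simp: is_nth_iff rev_nth)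

text \<open>In a certificate entry \<open>(r, h, m, \<kappa>, \<nu>)\<close>, modulo \<open>r\<close> we have $h^m = 1$, $h^\<kappa> = k$ and
  $h^\<nu> q = 1$. The construction is split into several definitions so that arguments occurring
  more than once are normalized before they are copied.\<close>

definition guarded_sieve where
  "guarded_sieve M b F u v t ls =
     Sieve M (guard (b \<and> final M ls u = zeros M \<and> final M ls v = zeros M) F) t (shifts M u v ls)"

definition table_sieve where
  "table_sieve M one\<^sub>r kr qr pows rpows sq \<kappa> \<nu> t v ls =
     guarded_sieve M (is_nth rpows 0 one\<^sub>r \<and> is_nth pows (nat_of_num \<kappa>) kr \<and> is_nth rpows (nat_of_num \<nu>) qr)
       (select sq pows (zeros M) Empty) (double M t) (double M v) t ls"

definition powers_sieve where
  "powers_sieve M N one\<^sub>r kr qr pows n \<kappa> \<nu> ls =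
     table_sieve M one\<^sub>r kr qr pows (rev_onto pows []) (shifted_squares N qr one\<^sub>r (Suc n) Empty)
       \<kappa> \<nu> (residue M \<kappa>) (residue M \<nu>) ls"

definition modulus_sieve where
  "modulus_sieve M N one\<^sub>r k q n h m \<kappa> \<nu> ls =
     powers_sieve M N one\<^sub>r (residue N k) (residue N q) (powers N h one\<^sub>r m) n \<kappa> \<nu> ls"

definition odd_sieve where
  "odd_sieve M N = modulus_sieve M N (one N)"

text \<open>\<open>num.Bit1 n\<close> hands over n = (r - 1)/2, the largest root whose square is
  listed, and \<open>num.Bit0 m\<close> guarantees a period above 1, as \<open>rep_residue\<close>
  demands. Other shapes get a sieve that admits everything.\<close>

fun sieve_mod :: "num \<Rightarrow> num \<Rightarrow> nat list \<Rightarrow> num \<Rightarrow> num \<Rightarrow> num \<Rightarrow> num \<Rightarrow> num \<Rightarrow> sieve" where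
  "sieve_mod k q ls (num.Bit1 n) h (num.Bit0 m) \<kappa> \<nu> =
     odd_sieve (inc (neg_bits (num.Bit0 m))) (inc (neg_bits (num.Bit1 n))) k q (nat_of_num n) h
       (nat_of_num (num.Bit0 m)) \<kappa> \<nu> ls"
| "sieve_mod k q ls _ h _ \<kappa> \<nu> = guarded_sieve [] False Full [] [] [] ls"

text \<open>a and 2n + 1 - a have congruent squares, so the roots 0, ..., n suffice.\<close>

lemma square_cong_small:
  fixes X n :: nat
  obtains i where "i \<le> n" "[i\<^sup>2 = X\<^sup>2] (mod (2 * n + 1))"
proof (cases "X mod (2 * n + 1) \<le> n")
  case True
  have "[(X mod (2 * n + 1))\<^sup>2 = X\<^sup>2] (mod (2 * n + 1))" by (simp add: cong_pow)
  then show ?thesis using True that by blast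
next
  case False
  define a where "a = X mod (2 * n + 1)"
  have a: "n < a" "a < 2 * n + 1" using False unfolding a_def by auto
  define i where "i = 2 * n + 1 - a"
  have "[int i = - int a] (mod int (2 * n + 1))"
    using a unfolding i_def cong_iff_dvd_diff by (simp add: of_nat_diff)
  then have "[(int i)\<^sup>2 = (- int a)\<^sup>2] (mod int (2 * n + 1))" by (rule cong_pow)
  then have "[int (i\<^sup>2) = int (a\<^sup>2)] (mod int (2 * n + 1))" by simp
  then have "[i\<^sup>2 = a\<^sup>2] (mod (2 * n + 1))" by (simp only: cong_int_iff)
  moreover have "[a\<^sup>2 = X\<^sup>2] (mod (2 * n + 1))" unfolding a_def by (simp add: cong_pow)
  ultimately have "[i\<^sup>2 = X\<^sup>2] (mod (2 * n + 1))" by (rule cong_trans)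
  moreover have "i \<le> n" using a unfolding i_def by linarith
  ultimately show ?thesis using that by blast
qed

text \<open>Multiplying a solution of $x^2 + q^{2Y+1} = k^{2Z+1}$ by $q^{-2Y}$ turns its right-hand side
  into a power of \<open>h\<close> whose exponent is linear in \<open>Y\<close> and \<open>Z\<close>.\<close>

lemma shifted_square_power:
  fixes x k q h r :: nat
  assumes sol: "x\<^sup>2 + q ^ (2 * Y + 1) = k ^ (2 * Z + 1)"
    and k: "[h ^ \<kappa> = k] (mod r)" and q: "[h ^ \<nu> * q = 1] (mod r)"
  shows "[(x * (h ^ \<nu>) ^ Y)\<^sup>2 + q = h ^ (\<kappa> + (2 * \<kappa>) * Z + (2 * \<nu>) * Y)] (mod r)"
proof -
  let ?w = "(h ^ \<nu>) ^ (2 * Y)"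
  have "[(h ^ \<nu> * q) ^ (2 * Y) = 1 ^ (2 * Y)] (mod r)" using q by (rule cong_pow)
  then have "[?w * q ^ (2 * Y) * q = 1 * q] (mod r)"
    by (intro cong_mult cong_refl) (simp add: power_mult_distrib)
  then have 1: "[?w * x\<^sup>2 + q = ?w * x\<^sup>2 + ?w * q ^ (2 * Y) * q] (mod r)"
    by (intro cong_add cong_refl) (simp add: cong_sym)
  have "(x * (h ^ \<nu>) ^ Y)\<^sup>2 + q = ?w * x\<^sup>2 + q"
    by (simp add: power_mult_distrib power_even_eq)
  also note 1
  also have "?w * x\<^sup>2 + ?w * q ^ (2 * Y) * q = ?w * k ^ (2 * Z + 1)"
    unfolding sol[symmetric] by (simp add: algebra_simps)
  also have "[?w * k ^ (2 * Z + 1) = ?w * (h ^ \<kappa>) ^ (2 * Z + 1)] (mod r)"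
    by (rule cong_mult[OF cong_refl cong_pow[OF cong_sym[OF k]]])
  also have "?w * (h ^ \<kappa>) ^ (2 * Z + 1) = h ^ (\<kappa> + (2 * \<kappa>) * Z + (2 * \<nu>) * Y)"
    by (simp add: power_mult[symmetric] power_add[symmetric] algebra_simps)
  finally show ?thesis .
qed

text \<open>A solution makes h^t - q a square, so t modulo the period belongs to \<open>F\<close>;
  if a check of the certificate fails, \<open>F\<close> has been replaced by
  \<open>Full\<close>.\<close>

lemma passes_sieve_mod:
  fixes x :: nat
  assumes sol: "x\<^sup>2 + numeral q ^ (2 * Y + 1) = numeral k ^ (2 * Z + 1)"
    and ls: "\<forall>l\<in>set ls. l > 0"
  shows "passes ls Y Z (sieve_mod k q ls r h period \<kappa> \<nu>)"
proof (cases "(k, q, ls, r, h, period, \<kappa>, \<nu>)" rule: sieve_mod.cases)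
  case (1 k' q' ls' n h' m \<kappa>' \<nu>')
  then have r: "r = num.Bit1 n" and period: "period = num.Bit0 m" by simp_all
  define N M where "N = inc (neg_bits r)" and "M = inc (neg_bits period)"
  define p where "p = 2 * numeral n + (1::nat)"
  have p: "numeral r = p" unfolding r p_def by (simp only: numeral_Bit1[of n] mult_2)
  have p1: "p > 1" by (simp add: p_def)
  have N: "modulus p N" and M: "modulus (numeral period) M"
    unfolding N_def M_def p[symmetric] by (rule modulus_neg_bits)+
  have m1: "numeral period > (1::nat)" by (simp add: period)
  define pw where "pw = powers N h (one N) (numeral period)"
  have pw: "rep p N (pw ! i) (numeral h ^ i)" if "i \<le> numeral period" for i
    using rep_powers[OF N rep_one[OF N p1] that, of h] by (simp add: pw_def)
  have len: "length pw = Suc (numeral period)" by (simp add: pw_def)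
  define sq where "sq = shifted_squares N (residue N q) (one N) (Suc (numeral n)) Empty"
  define F where "F = select sq pw (zeros M) Empty"
  define b where "b \<longleftrightarrow> is_nth (rev pw) 0 (one N) \<and> is_nth pw (numeral \<kappa>) (residue N k) \<and>
     is_nth (rev pw) (numeral \<nu>) (residue N q)"
  define u v where "u = double M (residue M \<kappa>)" and "v = double M (residue M \<nu>)"
  have eq: "sieve_mod k q ls r h period \<kappa> \<nu> = Sieve M
     (guard (b \<and> final M ls u = zeros M \<and> final M ls v = zeros M) F)
     (residue M \<kappa>) (shifts M u v ls)"
    by (simp only: r sieve_mod.simps odd_sieve_def modulus_sieve_def powers_sieve_def table_sieve_def
      guarded_sieve_def N_def M_def period pw_def sq_def F_def b_def u_def v_def nat_of_num_numeral rev_onto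
      append_Nil2 mult_2)
  show ?thesis unfolding eq
  proof (rule passes_guard, elim conjE)
    assume b and fin: "final M ls u = zeros M" "final M ls v = zeros M"
    have K: "rep (numeral period) M (residue M \<kappa>) (numeral \<kappa>)"
      and V: "rep (numeral period) M (residue M \<nu>) (numeral \<nu>)"
      by (rule rep_residue[OF M m1])+
    have u: "rep (numeral period) M u (2 * numeral \<kappa>)"
      and v: "rep (numeral period) M v (2 * numeral \<nu>)"
      unfolding u_def v_def double_def mult_2[of "numeral \<kappa>"] mult_2[of "numeral \<nu>"]
      using rep_madd[OF M K K] rep_madd[OF M V V] by auto
    from \<open>b\<close> have h1: "pw ! (numeral period) = one N"
      and hk: "numeral \<kappa> \<le> (numeral period :: nat)" "pw ! numeral \<kappa> = residue N k"
      and hq: "numeral \<nu> \<le> (numeral period :: nat)" "pw ! (numeral period - numeral \<nu>) = residue N q"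
      unfolding b_def is_nth_length_Suc[OF len] diff_zero by blast+
    have h1: "[numeral h ^ (numeral period) = 1] (mod p)"
      using rep_unique[OF pw[OF order_refl] rep_one[OF N p1]] h1 by simp
    have hk: "[numeral h ^ numeral \<kappa> = numeral k] (mod p)"
      using rep_unique[OF pw[OF hk(1)] rep_residue[OF N p1]] hk(2) by simp
    \<comment> \<open>As h^period = 1, this entry of the table is the inverse of h^\<nu>.\<close>
    have "[numeral h ^ (numeral period - numeral \<nu>) = numeral q] (mod p)"
      by (rule iffD2[OF rep_unique[OF pw[OF diff_le_self] rep_residue[OF N p1]] hq(2)])
    then have "[numeral h ^ numeral \<nu> * numeral q =
        numeral h ^ numeral \<nu> * numeral h ^ (numeral period - numeral \<nu>)] (mod p)"
      by (rule cong_mult[OF cong_refl cong_sym])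
    also have "numeral h ^ numeral \<nu> * numeral h ^ (numeral period - numeral \<nu>) =
        (numeral h ^ (numeral period) :: nat)"
      by (simp only: power_add[symmetric] le_add_diff_inverse[OF hq(1)])
    finally have hq: "[numeral h ^ numeral \<nu> * numeral q = 1] (mod p)"
      using h1 cong_trans by blast
    show "passes ls Y Z (Sieve M F (residue M \<kappa>) (shifts M u v ls))"
    proof (rule passes_Sieve[OF M ls K u v fin])
      fix c assume c: "rep (numeral period) M c
        (numeral \<kappa> + 2 * numeral \<kappa> * Z + 2 * numeral \<nu> * Y)"
      let ?t = "numeral \<kappa> + 2 * numeral \<kappa> * Z + 2 * numeral \<nu> * Y :: nat"
      \<comment> \<open>Powers are tabulated only up to the period, so t is reduced before it serves
        as an index.\<close>
      define e where "e = ?t mod (numeral period)"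
      have e: "e < numeral period" by (simp add: e_def)
      obtain X where X: "[X\<^sup>2 + numeral q = numeral h ^ ?t] (mod p)"
        using shifted_square_power[OF sol hk hq] by blast
      obtain i where i: "i \<le> numeral n" "[i\<^sup>2 = X\<^sup>2] (mod p)"
        using square_cong_small[of "numeral n" X] unfolding p_def by blast
      have "numeral h ^ ?t = (numeral h ^ (numeral period)) ^ (?t div (numeral period)) * (numeral h ^ e :: nat)"
        unfolding e_def power_mult[symmetric] power_add[symmetric] by simp
      moreover have "[(numeral h ^ (numeral period)) ^ (?t div (numeral period)) * numeral h ^ e =
          1 ^ (?t div (numeral period)) * numeral h ^ e] (mod p)"
        by (intro cong_mult cong_refl cong_pow h1)
      ultimately have "[numeral h ^ ?t = numeral h ^ e] (mod p)" by simp
      note cong_sym[OF this]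
      also note cong_sym[OF X]
      also note cong_add[OF cong_sym[OF i(2)] cong_refl]
      finally have "[numeral h ^ e = (0 + i)\<^sup>2 + numeral q] (mod p)" by simp
      then have rp: "rep p N (pw ! e) ((0 + i)\<^sup>2 + numeral q)"
        using rep_cong[OF pw] e by simp
      have look: "look sq (pw ! e)" unfolding sq_def
      proof (rule look_shifted_squares[OF N _ _ _ _ _ rp])
        show "rep p N (residue N q) (0\<^sup>2 + numeral q)" using rep_residue[OF N p1] by simp
        show "length (one N) = length N" "val (one N) = 2 * 0 + 1"
          using rep_one[OF N p1] p1 by (auto simp: rep_def)
        show "2 * (0 + Suc (numeral n)) \<le> p + 1" by (simp add: p_def)
      qed (rule le_imp_less_Suc[OF i(1)])
      have len: "e < length pw" unfolding len using e by (rule less_SucI)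
      show "look F c" unfolding F_def
      proof (rule look_select[OF len look])
        show "length (zeros M) = length c" "val (zeros M) + e = val c"
          \<comment> \<open>Only the length and the value of \<open>zeros M\<close> are wanted here;
            the modulus 1 is arbitrary.\<close>
          using rep_zeros[of 1 M] c e_def by (auto simp: rep_def)
      qed
    qed
  qed
qed (auto simp: guarded_sieve_def passes_Full)

fun sieves :: "num \<Rightarrow> num \<Rightarrow> nat list \<Rightarrow> (nat \<times> nat \<times> nat \<times> nat \<times> nat) list \<Rightarrow> sieve list" where
  "sieves k q ls [] = []"
| "sieves k q ls ((r, h, m, \<kappa>, \<nu>) # g) =
     sieve_mod k q ls (num_of_nat r) (num_of_nat h) (num_of_nat m) (num_of_nat \<kappa>) (num_of_nat \<nu>) #
     sieves k q ls g"

text \<open>A group is built over the radices up to its own stage only, so its final weights are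
  checked to vanish exactly where the group is used.\<close>

fun stages :: "num \<Rightarrow> num \<Rightarrow> nat list \<Rightarrow> nat \<Rightarrow> (nat \<times> nat \<times> nat \<times> nat \<times> nat) list list \<Rightarrow> sieve list list" where
  "stages k q ls i [] = []"
| "stages k q ls i (g # gs) = sieves k q (take i ls) g # stages k q ls (Suc i) gs"

definition covers where
  "covers k q ls gs = sieved (stages k q ls (Suc 0) gs) ls"

text \<open>The detour through \<open>num\<close> turns a numeral into a \<open>Suc\<close> term, on
  which the recursions match, and makes each radix positive by construction.\<close>

fun positives :: "nat list \<Rightarrow> nat list" where
  "positives [] = []"
| "positives (l # ls) = nat_of_num (num_of_nat l) # positives ls"

definition no_odd_solution where
  "no_odd_solution k q ls gs = covers (num_of_nat k) (num_of_nat q) (positives ls) gs"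

lemma no_odd_solution:
  fixes x :: nat
  assumes "no_odd_solution k q ls gs" "k > 0" "q > 0"
  shows "x\<^sup>2 + q ^ (2 * Y + 1) \<noteq> k ^ (2 * Z + 1)"
proof
  assume sol: "x\<^sup>2 + q ^ (2 * Y + 1) = k ^ (2 * Z + 1)"
  define k' q' ls' where "k' = num_of_nat k" and "q' = num_of_nat q" and "ls' = positives ls"
  have "k = numeral k'" "q = numeral q'"
    using assms by (auto simp: k'_def q'_def numeral_num_of_nat)
  with sol have sol: "x\<^sup>2 + numeral q' ^ (2 * Y + 1) = numeral k' ^ (2 * Z + 1)" by simp
  have ls: "\<forall>l\<in>set ls'. l > 0"
    unfolding ls'_def by (induction ls) (auto simp: nat_of_num_pos)
  have *: "passes l Y Z s" if "s \<in> set (sieves k' q' l g)" "\<forall>a\<in>set l. a > 0" for s l g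
  proof -
    have "\<exists>r h m \<kappa> \<nu>. s = sieve_mod k' q' l r h m \<kappa> \<nu>" using that(1)
    proof (induction g)
      case (Cons d g)
      then show ?case by (cases d) (simp; blast)
    qed simp
    then show ?thesis using passes_sieve_mod[OF sol that(2)] by blast
  qed
  have st: "stages k' q' ls' i gs ! n = sieves k' q' (take (i + n) ls') (gs ! n)" if "n < length gs" for i n
    using that by (induction gs arbitrary: i n) (auto simp: nth_Cons split: nat.splits)
  have l: "length (stages k' q' ls' i gs) = length gs" for i
    by (induction gs arbitrary: i) auto
  show False
  proof (rule sieved_imp_False[OF _ ls])
    show "sieved (stages k' q' ls' (Suc 0) gs) ls'"
      using assms(1) by (simp add: no_odd_solution_def covers_def k'_def q'_def ls'_def)
    fix n s assume "n < length (stages k' q' ls' (Suc 0) gs)"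
      "s \<in> set (stages k' q' ls' (Suc 0) gs ! n)"
    then show "passes (take (Suc n) ls') Y Z s"
      using st[of n "Suc 0"] l ls by (intro *[where g = "gs ! n"]) (auto dest: in_set_takeD)
  qed
qed


section \<open>Rewrite rules that evaluate the sieve lazily\<close>

definition probe where
  "probe b j g \<longleftrightarrow> \<not> b \<or> excluded j g"

definition rows where
  "rows n l g gs ls \<longleftrightarrow> (\<forall>i<n. \<forall>j<l. excluded j (map (shift_y i) g) \<or>
     sieved (map (map (shift_z j)) (map (map (shift_y i)) gs)) ls)"

definition cells where
  "cells n g gs ls \<longleftrightarrow> (\<forall>j<n. excluded j g \<or> sieved (map (map (shift_z j)) gs) ls)"

definition cell where
  "cell b j gs ls \<longleftrightarrow> b \<or> sieved (map (map (shift_z j)) gs) ls"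

text \<open>Both sides of a disjunction would be normalized. With \<open>probe\<close> here and
  \<open>cell\<close> below, the second alternative is formed only after the first has been
  evaluated and has failed.\<close>

lemma excluded_rules:
  "excluded j [] = False"
  "excluded j (Sieve N F t ((A, B) # st) # g) = probe (look F (madd N t (B ! j))) j g"
  "probe False j g = True"
  "probe True j g = excluded j g"
  by (auto simp: probe_def)

lemma sieved_rules:
  "sieved [] ls = False"
  "sieved (g # gs) (l # ls) = rows l l g gs ls"
  "rows 0 l g gs ls = True"
  "rows (Suc n) l g gs ls =
     (cells l (map (shift_y n) g) (map (map (shift_y n)) gs) ls \<and> rows n l g gs ls)"
  "cells 0 g gs ls = True"
  "cells (Suc n) g gs ls = (cell (excluded n g) n gs ls \<and> cells n g gs ls)"
  "cell True j gs ls = True"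
  "cell False j gs ls = sieved (map (map (shift_z j)) gs) ls"
  by (auto simp: rows_def cells_def cell_def less_Suc_eq)

lemma num_of_nat_rules:
  "num_of_nat (numeral n) = n" "num_of_nat 1 = num.One"
  by (simp_all add: num_of_nat_numeral_eq)

lemmas evaluation_rules = add.simps top_bit.simps inc.simps cond.simps reduce_def sub_if_ge_def
  madd_def zeros.simps one_def times.simps double_def mult.simps residue.simps neg_bits.simps look.simps
  put.simps shifted_squares.simps powers.simps put_if.simps select.simps multiples.simps shifts.simps
  final.simps shift_y.simps shift_z.simps excluded_rules sieved_rules rev_onto.simps guard.simps
  is_nth.simps guarded_sieve_def table_sieve_def powers_sieve_def modulus_sieve_def odd_sieve_def
  sieve_mod.simps sieves.simps stages.simps covers_def positives.simps no_odd_solution_def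
  num_of_nat_rules nat_of_num.simps add_Suc add_0 take_0 take_Suc_Cons nth_Cons_0 nth_Cons_Suc
  list.map simp_thms

section \<open>The equation\<close>

definition odd_unsolvable :: "nat \<Rightarrow> bool" where
  "odd_unsolvable k \<longleftrightarrow> (\<forall>x Y Z :: nat. x\<^sup>2 + (2 * k - 1) ^ (2 * Y + 1) \<noteq> k ^ (2 * Z + 1))"

text \<open>\<open>q\<close> is passed as a literal, so that the evaluation need not subtract;
  \<open>q = 2 * k - 1\<close> is checked apart.\<close>

lemma odd_unsolvableI:
  "no_odd_solution k q ls gs \<Longrightarrow> q = 2 * k - 1 \<Longrightarrow> 0 < k \<Longrightarrow> odd_unsolvable k"
  using no_odd_solution[of k q ls gs] by (auto simp: odd_unsolvable_def)

section \<open>Certificates for the 36 non-square values of k\<close>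

lemma odd_unsolvable_12: "odd_unsolvable 12"
  by (rule odd_unsolvableI[of 12 23 "[3, 2, 7, 3, 3, 5]"
    "[[(13, 4, 6, 3, 1), (7, 3, 6, 5, 4)], [], [(43, 3, 42, 13, 26), (29, 2, 28, 7,
     8), (673, 12, 28, 1, 6)], [(37, 2, 36, 28, 21), (73, 6, 36, 17, 7), (127, 3,
     126, 19, 5)], [(271, 12, 54, 1, 33), (109, 6, 108, 58, 75)], [(31, 3, 30, 19,
     3), (61, 2, 60, 8, 3), (211, 8, 70, 15, 63)]]"];
    (simp only: evaluation_rules | simp))

lemma odd_unsolvable_52: "odd_unsolvable 52"
  by (rule odd_unsolvableI[of 52 103 "[5, 3, 7, 2, 2, 2, 3, 2]"
    "[[(11, 2, 10, 3, 8)], [(61, 4, 30, 21, 2), (31, 3, 30, 29, 16), (7, 3, 6, 1,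
     1)], [(43, 3, 42, 2, 4), (71, 7, 70, 51, 40), (211, 2, 210, 146, 184), (29, 4,
     14, 10, 12)], [(421, 2, 420, 65, 244), (337, 36, 28, 16, 1)], [(73, 7, 24, 11,
     17), (41, 6, 40, 3, 26), (281, 3, 280, 137, 251), (617, 6, 56, 17, 1)], [(113,
     3, 112, 46, 73), (241, 7, 240, 187, 171), (673, 6, 336, 186, 257)], [(127, 24,
     18, 4, 8), (19, 2, 18, 7, 15), (37, 2, 36, 13, 15), (181, 2, 180, 166, 49),
     (631, 3, 630, 387, 223), (2521, 2, 1260, 106, 899)], [(97, 5, 96, 93, 88), (641,
     11, 160, 67, 114)]]"];
    (simp only: evaluation_rules | simp))

text \<open>An empty group closes nothing: the first binary digits only prepare for the modulus 17,
  where t = 3 + 6Z + 6Y modulo 8 is known after two digits.\<close>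

lemma odd_unsolvable_76: "odd_unsolvable 76"
  by (rule odd_unsolvableI[of 76 151 "[2, 2, 3, 5, 2, 3]"
    "[[], [(17, 2, 8, 3, 3)], [(13, 2, 12, 7, 9), (7, 3, 6, 3, 2)], [(61, 2, 60,
     28, 25), (11, 2, 10, 5, 7), (31, 3, 30, 22, 27), (41, 6, 40, 21, 29), (601, 17,
     120, 53, 16)], [(241, 7, 240, 225, 148), (401, 26, 80, 47, 14)], [(37, 2, 36, 1,
     10), (73, 5, 72, 6, 71), (577, 2, 144, 53, 119)]]"];
    (simp only: evaluation_rules | simp))

lemma odd_unsolvable_84: "odd_unsolvable 84"
  by (rule odd_unsolvableI[of 84 167 "[2, 3, 3, 5, 2, 7]"
    "[[(5, 2, 4, 2, 3)], [(13, 2, 12, 5, 5)], [(37, 2, 36, 24, 1), (19, 2, 18, 3,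
     7)], [(61, 2, 60, 57, 26), (11, 2, 10, 7, 9), (31, 3, 30, 17, 11), (181, 2,
     180, 73, 74), (271, 24, 90, 63, 22)], [(41, 6, 40, 26, 25), (73, 5, 72, 55,
     33)], [(43, 3, 42, 6, 38), (29, 2, 28, 19, 2), (211, 2, 210, 184, 151), (71, 7,
     70, 39, 14), (127, 3, 126, 8, 75), (379, 8, 126, 98, 50), (337, 3, 168, 20,
     115), (281, 3, 280, 31, 274), (2521, 2, 1260, 694, 561)]]"];
    (simp only: evaluation_rules | simp))

lemma odd_unsolvable_132: "odd_unsolvable 132"
  by (rule odd_unsolvableI[of 132 263 "[3, 3, 2, 2, 5, 7, 2]"
    "[[(7, 3, 6, 3, 2)], [(19, 2, 18, 9, 14), (37, 3, 18, 5, 11)], [(13, 2, 12, 1,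
     8), (109, 2, 36, 29, 12)], [(17, 2, 8, 6, 5), (73, 5, 72, 5, 1)], [(61, 2, 60,
     23, 34), (181, 36, 30, 20, 4), (41, 6, 40, 30, 7), (31, 15, 10, 2, 9)], [(29,
     2, 28, 4, 27), (127, 3, 126, 87, 124), (71, 7, 70, 69, 8), (281, 5, 140, 127,
     99), (211, 2, 210, 207, 64), (43, 3, 42, 1, 17)], [(241, 7, 240, 107, 25)]]"];
    (simp only: evaluation_rules | simp))

lemma odd_unsolvable_156: "odd_unsolvable 156"
  by (rule odd_unsolvableI[of 156 311 "[3, 5, 2, 7, 2, 2, 3, 2, 2]"
    "[[(7, 3, 6, 2, 5)], [(11, 2, 10, 1, 2), (211, 10, 30, 3, 28)], [(61, 2, 60,
     48, 53), (181, 6, 60, 26, 7)], [(43, 3, 42, 3, 32), (29, 2, 28, 25, 11), (71,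
     7, 70, 7, 62), (421, 2, 420, 49, 395)], [(41, 6, 40, 18, 27), (337, 3, 168, 49,
     68), (281, 3, 280, 138, 169)], [(17, 3, 16, 1, 11), (113, 3, 112, 47, 24), (241,
     7, 240, 129, 151)], [(37, 2, 36, 3, 23), (19, 2, 18, 2, 12), (127, 3, 126, 113,
     41), (73, 5, 72, 9, 10), (631, 3, 630, 388, 411)], [(97, 5, 96, 67, 27), (673,
     5, 672, 272, 295)], [(193, 5, 192, 101, 10)]]"];
    (simp only: evaluation_rules | simp))

lemma odd_unsolvable_172: "odd_unsolvable 172"
  by (rule odd_unsolvableI[of 172 343 "[2, 3, 3, 2, 2, 5, 5, 7]"
    "[[], [(13, 2, 12, 4, 3)], [(109, 4, 18, 6, 16), (37, 2, 36, 29, 12)], [(73, 5,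
     72, 67, 45), (2377, 119, 72, 57, 40)], [(17, 3, 16, 14, 15), (193, 4, 48, 7,
     18), (433, 42, 144, 111, 11)], [(41, 6, 40, 38, 3), (11, 2, 10, 7, 9), (31, 3,
     30, 7, 6), (181, 2, 180, 22, 135), (541, 7, 90, 61, 87), (241, 7, 240, 119,
     237)], [(101, 2, 100, 44, 73), (151, 6, 150, 148, 99), (401, 2, 200, 13, 39)],
     [(29, 2, 28, 15, 20), (71, 7, 70, 60, 67), (281, 5, 140, 30, 119), (211, 2,
     210, 82, 3), (113, 3, 112, 71, 88), (127, 3, 126, 89, 33)]]"];
    (simp only: evaluation_rules | simp))

lemma odd_unsolvable_180: "odd_unsolvable 180"
  by (rule odd_unsolvableI[of 180 359 "[5, 3, 2, 2, 3]"
    "[[(11, 2, 10, 2, 3), (41, 4, 10, 2, 1)], [(7, 3, 6, 5, 4), (31, 3, 30, 10,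
     4)], [(13, 2, 12, 7, 9), (61, 2, 60, 36, 41)], [(241, 3, 120, 51, 26)], [(109,
     2, 36, 26, 31), (37, 2, 36, 5, 24), (73, 5, 72, 29, 22)]]"];
    (simp only: evaluation_rules | simp))

text \<open>The shortest certificate can be followed by hand. Modulo 13, t = 3 + 2Y modulo 6, and
  only Y = 1 modulo 3 leaves a square. Modulo 19, t is then 4, 10 or 16 modulo 18, and 2^t - 439 is
  14, 15 or 3, none of them a square.\<close>

lemma odd_unsolvable_220: "odd_unsolvable 220"
  by (rule odd_unsolvableI[of 220 439 "[3, 3]"
    "[[(13, 4, 6, 3, 1)], [(19, 2, 18, 12, 17)]]"];
    (simp only: evaluation_rules | simp))

lemma odd_unsolvable_244: "odd_unsolvable 244"
  by (rule odd_unsolvableI[of 244 487 "[2, 5, 3, 3, 7, 3, 2]"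
    "[[(5, 2, 4, 2, 3)], [(41, 2, 20, 11, 3), (11, 2, 10, 1, 2)], [(7, 3, 6, 3, 2),
     (31, 3, 30, 3, 13), (13, 2, 12, 10, 7)], [(19, 2, 18, 4, 3), (73, 6, 36, 31,
     21), (37, 2, 36, 31, 9), (181, 2, 180, 127, 72), (271, 24, 90, 54, 83)], [(71,
     7, 70, 11, 1), (29, 2, 28, 7, 8), (43, 3, 42, 41, 22), (211, 2, 210, 205, 144),
     (127, 3, 126, 96, 73)], [(109, 6, 108, 16, 71)], [(241, 3, 120, 1, 81)]]"];
    (simp only: evaluation_rules | simp))

lemma odd_unsolvable_252: "odd_unsolvable 252"
  by (rule odd_unsolvableI[of 252 503 "[5, 3, 2, 3, 7, 2, 3]"
    "[[(11, 2, 10, 5, 7)], [(31, 3, 30, 18, 2), (421, 12, 30, 6, 22)], [(61, 2, 60,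
     3, 32), (13, 2, 12, 9, 4), (181, 6, 60, 37, 43)], [(19, 2, 18, 16, 10), (37, 2,
     36, 14, 5), (271, 24, 90, 66, 17), (541, 8, 180, 156, 17)], [(29, 2, 28, 24, 5),
     (43, 3, 42, 7, 31), (211, 2, 210, 17, 38), (71, 7, 70, 65, 38), (281, 2, 70,
     18, 45), (127, 5, 42, 3, 20), (1009, 4, 252, 125, 98)], [(113, 9, 56, 17, 53),
     (41, 6, 40, 1, 37), (73, 5, 72, 61, 12)], [(109, 6, 108, 42, 13)]]"];
    (simp only: evaluation_rules | simp))

lemma odd_unsolvable_300: "odd_unsolvable 300"
  by (rule odd_unsolvableI[of 300 599 "[3, 3, 5, 7, 2, 3]"
    "[[(7, 3, 6, 3, 2)], [(37, 3, 18, 7, 14), (19, 2, 18, 11, 1)], [(31, 3, 30, 29,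
     16), (11, 2, 10, 8, 6), (271, 3, 30, 25, 22), (181, 4, 90, 5, 81)], [(43, 3,
     42, 21, 20), (71, 7, 70, 24, 59), (127, 3, 126, 67, 43), (211, 2, 210, 99, 115),
     (421, 4, 210, 61, 145), (631, 3, 630, 89, 455)], [(29, 2, 28, 23, 19), (61, 2,
     60, 52, 15), (109, 2, 36, 34, 19), (337, 9, 84, 31, 43)], [(541, 4, 270, 9,
     130)]]"];
    (simp only: evaluation_rules | simp))

lemma odd_unsolvable_316: "odd_unsolvable 316"
  by (rule odd_unsolvableI[of 316 631 "[2, 3, 2, 2, 7, 5, 2, 2, 3]"
    "[[], [(13, 2, 12, 2, 1), (61, 32, 12, 3, 1)], [], [(17, 3, 16, 3, 2), (97, 2,
     48, 17, 1)], [(43, 3, 42, 26, 1), (29, 2, 28, 19, 2), (337, 3, 168, 40, 57),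
     (113, 3, 112, 97, 25), (1009, 23, 336, 241, 60)], [(41, 6, 40, 7, 16), (71, 7,
     70, 30, 17), (11, 2, 10, 3, 8), (211, 2, 210, 104, 104), (31, 3, 30, 25, 7),
     (281, 5, 140, 8, 17), (421, 2, 420, 418, 211)], [(641, 11, 160, 27, 65)], [(449,
     3, 448, 445, 35)], [(127, 3, 126, 118, 45)]]"];
    (simp only: evaluation_rules | simp))

lemma odd_unsolvable_364: "odd_unsolvable 364"
  by (rule odd_unsolvableI[of 364 727 "[2, 3, 5, 3, 7, 2]"
    "[[(5, 2, 4, 2, 3)], [(73, 3, 12, 6, 5)], [(61, 2, 60, 31, 8), (31, 3, 30, 27,
     8), (241, 9, 60, 17, 55)], [(19, 2, 18, 13, 2), (37, 2, 36, 9, 7), (181, 2,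
     180, 1, 124), (271, 24, 90, 85, 68)], [(29, 2, 28, 4, 27), (211, 32, 42, 15,
     17), (71, 7, 70, 52, 21), (43, 3, 42, 37, 9), (127, 3, 126, 101, 113), (421, 2,
     420, 11, 165), (631, 3, 630, 26, 139)], [(41, 6, 40, 2, 17), (113, 9, 56, 27,
     48)]]"];
    (simp only: evaluation_rules | simp))

lemma odd_unsolvable_372: "odd_unsolvable 372"
  by (rule odd_unsolvableI[of 372 743 "[2, 3, 3, 2, 7, 5]"
    "[[], [(13, 2, 12, 3, 11)], [(19, 2, 18, 12, 17), (37, 2, 36, 1, 10)], [(73, 5,
     72, 33, 13), (97, 4, 24, 14, 21)], [(211, 32, 42, 32, 25), (43, 3, 42, 5, 29),
     (29, 2, 28, 8, 17), (127, 3, 126, 65, 105), (617, 6, 56, 5, 36)], [(11, 2, 10,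
     6, 1), (61, 2, 60, 7, 45), (101, 32, 20, 11, 12), (41, 6, 40, 15, 18), (181, 2,
     180, 157, 45)]]"];
    (simp only: evaluation_rules | simp))

lemma odd_unsolvable_412: "odd_unsolvable 412"
  by (rule odd_unsolvableI[of 412 823 "[3, 5, 2, 2, 3, 2]"
    "[[(7, 3, 6, 3, 2), (13, 4, 6, 4, 5)], [(11, 2, 10, 4, 4), (31, 3, 30, 2, 23),
     (211, 10, 30, 16, 1)], [(61, 2, 60, 58, 31)], [(97, 4, 24, 11, 3), (41, 6, 40,
     26, 25)], [(19, 2, 18, 5, 4), (37, 2, 36, 23, 20), (73, 5, 72, 31, 55)], [(17,
     3, 16, 12, 5)]]"];
    (simp only: evaluation_rules | simp))

lemma odd_unsolvable_420: "odd_unsolvable 420"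
  by (rule odd_unsolvableI[of 420 839 "[2, 3, 3, 5, 7, 2, 3, 2]"
    "[[], [(13, 2, 12, 2, 1)], [(19, 2, 18, 1, 5), (37, 2, 36, 11, 26), (109, 2, 36,
     22, 27), (73, 18, 18, 10, 13)], [(11, 2, 10, 1, 2), (31, 3, 30, 7, 6), (61, 2,
     60, 19, 2), (181, 2, 180, 49, 151), (1171, 39, 90, 60, 4)], [(43, 3, 42, 31,
     27), (29, 2, 28, 13, 13), (211, 2, 210, 106, 183), (127, 3, 126, 95, 69), (71,
     7, 70, 67, 66), (421, 4, 210, 105, 113)], [(41, 6, 40, 8, 31), (281, 3, 280,
     217, 12)], [(379, 2, 378, 60, 208), (433, 6, 216, 67, 204), (811, 2, 270, 97,
     98), (541, 31, 54, 2, 17)], [(17, 3, 16, 13, 1), (113, 3, 112, 4, 63), (241, 7,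
     240, 221, 186)]]"];
    (simp only: evaluation_rules | simp))

lemma odd_unsolvable_444: "odd_unsolvable 444"
  by (rule odd_unsolvableI[of 444 887 "[2, 3, 5, 7, 2, 2, 3, 2, 2]"
    "[[(5, 2, 4, 2, 3)], [(13, 2, 12, 1, 8), (7, 3, 6, 1, 1)], [(11, 2, 10, 2, 3),
     (61, 2, 60, 47, 39), (31, 3, 30, 14, 26)], [(43, 3, 42, 20, 39), (29, 2, 28,
     10, 7), (71, 7, 70, 58, 41), (127, 63, 14, 1, 1), (211, 2, 210, 163, 130), (421,
     2, 420, 187, 174)], [(41, 6, 40, 19, 23), (449, 16, 56, 40, 37)], [(17, 3, 16,
     14, 15), (113, 3, 112, 92, 51), (241, 7, 240, 155, 94), (337, 10, 336, 62, 131)],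
     [(19, 2, 18, 6, 13), (181, 2, 180, 84, 157), (73, 5, 72, 14, 17)], [(97, 5, 96,
     37, 31)], [(193, 5, 192, 157, 29)]]"];
    (simp only: evaluation_rules | simp))

lemma odd_unsolvable_460: "odd_unsolvable 460"
  by (rule odd_unsolvableI[of 460 919 "[3, 5, 2, 2, 7, 3, 2]"
    "[[(7, 3, 6, 5, 4)], [(11, 2, 10, 6, 1), (31, 3, 30, 5, 22), (751, 78, 30, 12,
     2)], [(13, 2, 12, 9, 4), (61, 2, 60, 21, 58)], [(73, 7, 24, 15, 5), (41, 6, 40,
     30, 7)], [(113, 2, 28, 3, 21), (43, 3, 42, 11, 18), (29, 4, 14, 8, 2), (211, 2,
     210, 155, 113), (421, 2, 420, 47, 98), (281, 3, 280, 231, 211), (71, 7, 70, 55,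
     23)], [(37, 2, 36, 4, 27), (19, 2, 18, 2, 12), (181, 2, 180, 31, 164)], [(337,
     5, 112, 6, 51)]]"];
    (simp only: evaluation_rules | simp))

lemma odd_unsolvable_492: "odd_unsolvable 492"
  by (rule odd_unsolvableI[of 492 983 "[3, 3, 2, 5, 3, 2, 2]"
    "[[(7, 3, 6, 2, 5)], [(19, 2, 18, 10, 11), (37, 3, 18, 15, 13)], [(13, 2, 12,
     7, 9)], [(31, 3, 30, 3, 13), (11, 2, 10, 3, 8), (61, 2, 60, 2, 11), (181, 2,
     180, 141, 139)], [(109, 6, 108, 103, 51)], [(73, 5, 72, 26, 43), (433, 6, 216,
     188, 33)], [(17, 3, 16, 8, 7), (241, 7, 240, 88, 155)]]"];
    (simp only: evaluation_rules | simp))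

text \<open>Six factors 2 among the radices make room for moduli r with r - 1 divisible by 32 or
  more: 193, 353, 577, 641 and 769.\<close>

lemma odd_unsolvable_516: "odd_unsolvable 516"
  by (rule odd_unsolvableI[of 516 1031 "[3, 3, 11, 5, 2, 2, 2, 2, 2, 2, 3]"
    "[[(7, 3, 6, 5, 4)], [(19, 2, 18, 13, 2)], [(23, 5, 22, 3, 7), (67, 2, 66, 50,
     46), (397, 3, 198, 139, 175), (331, 13, 66, 7, 15), (199, 3, 198, 103, 182)],
     [(181, 4, 90, 39, 26), (11, 2, 10, 5, 7), (31, 3, 30, 8, 18), (661, 4, 330,
     149, 202), (991, 6, 990, 67, 950), (2971, 23, 330, 26, 221)], [(61, 2, 60, 51,
     23), (37, 2, 36, 19, 31), (1321, 5, 660, 264, 89)], [(41, 6, 40, 13, 39), (73,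
     5, 72, 1, 60), (89, 3, 88, 62, 33)], [(17, 3, 16, 15, 9), (97, 2, 48, 7, 32),
     (241, 7, 240, 61, 74), (881, 3, 880, 171, 339)], [(353, 3, 352, 15, 101)], [(193,
     5, 192, 176, 83), (577, 5, 576, 229, 81)], [(769, 2, 384, 342, 115), (641, 3,
     640, 370, 227)], [(163, 5, 54, 31, 12), (109, 6, 108, 88, 7), (271, 6, 270, 184,
     169), (433, 5, 432, 229, 333), (541, 2, 540, 182, 67)]]"];
    (simp only: evaluation_rules | simp))

lemma odd_unsolvable_532: "odd_unsolvable 532"
  by (rule odd_unsolvableI[of 532 1063 "[3, 2, 2, 3, 3]"
    "[[(13, 4, 6, 3, 1)], [(37, 8, 12, 11, 10)], [(41, 3, 8, 4, 3), (97, 4, 24, 21,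
     11)], [(73, 5, 72, 39, 68)], [(433, 6, 216, 39, 142)]]"];
    (simp only: evaluation_rules | simp))

lemma odd_unsolvable_612: "odd_unsolvable 612"
  by (rule odd_unsolvableI[of 612 1223 "[3, 5, 2, 3, 7, 2, 2]"
    "[[(7, 3, 6, 1, 1)], [(11, 2, 10, 7, 9), (31, 3, 30, 27, 8)], [(61, 2, 60, 1,
     54)], [(19, 2, 18, 2, 12), (37, 2, 36, 25, 35), (181, 2, 180, 109, 26), (541, 8,
     180, 103, 118)], [(29, 2, 28, 5, 6), (127, 3, 126, 58, 3), (43, 3, 42, 10, 23),
     (211, 2, 210, 77, 25), (71, 7, 70, 43, 46), (701, 32, 140, 14, 137), (421, 2,
     420, 256, 349), (631, 3, 630, 496, 123)], [(41, 6, 40, 35, 21), (73, 5, 72, 49,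
     16), (281, 3, 280, 16, 25)], [(113, 3, 112, 31, 61), (337, 5, 112, 109, 53),
     (241, 7, 240, 135, 166)]]"];
    (simp only: evaluation_rules | simp))

lemma odd_unsolvable_652: "odd_unsolvable 652"
  by (rule odd_unsolvableI[of 652 1303 "[2, 3, 5, 7, 2, 2, 3, 3]"
    "[[], [(13, 2, 12, 1, 8), (37, 8, 12, 5, 11)], [(11, 2, 10, 8, 6), (41, 2, 20,
     12, 15), (61, 4, 30, 28, 22)], [(43, 3, 42, 35, 10), (29, 2, 28, 13, 13), (71,
     7, 70, 39, 14), (211, 2, 210, 154, 92), (421, 2, 420, 306, 139)], [(113, 9, 56,
     45, 2), (281, 67, 40, 32, 29), (2689, 45, 168, 166, 115)], [(17, 3, 16, 15, 9),
     (241, 7, 240, 199, 48), (337, 10, 336, 307, 179)], [(19, 2, 18, 14, 6), (73, 5,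
     72, 37, 53), (181, 2, 180, 25, 66), (127, 3, 126, 38, 57)], [(379, 2, 378, 227,
     245), (271, 6, 270, 22, 202)]]"];
    (simp only: evaluation_rules | simp))

lemma odd_unsolvable_660: "odd_unsolvable 660"
  by (rule odd_unsolvableI[of 660 1319 "[11, 3, 5]"
    "[[(23, 5, 22, 8, 16), (199, 11, 22, 6, 2), (661, 3, 22, 11, 10)], [(7, 3, 6,
     2, 5)], [(31, 3, 30, 2, 23), (331, 3, 330, 286, 259)]]"];
    (simp only: evaluation_rules | simp))

lemma odd_unsolvable_684: "odd_unsolvable 684"
  by (rule odd_unsolvableI[of 684 1367 "[2, 3, 5, 7, 2, 2, 2, 2, 3]"
    "[[(5, 2, 4, 2, 3)], [(7, 3, 6, 5, 4), (13, 2, 12, 3, 11)], [(31, 3, 30, 24,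
     29), (11, 2, 10, 1, 2), (61, 4, 30, 20, 8)], [(29, 2, 28, 21, 26), (43, 3, 42,
     33, 19), (71, 7, 70, 10, 12), (211, 2, 210, 32, 20), (421, 8, 140, 69, 118),
     (701, 6, 70, 12, 8)], [(41, 6, 40, 11, 15), (281, 3, 280, 71, 275)], [(17, 3,
     16, 12, 5), (113, 3, 112, 13, 38), (241, 7, 240, 109, 42)], [(97, 5, 96, 1,
     52)], [(193, 5, 192, 189, 56), (769, 4, 192, 9, 88)], [(37, 2, 36, 17, 17), (73,
     5, 72, 18, 19)]]"];
    (simp only: evaluation_rules | simp))

lemma odd_unsolvable_700: "odd_unsolvable 700"
  by (rule odd_unsolvableI[of 700 1399 "[3, 3, 7, 5, 2, 3]"
    "[[], [(19, 2, 18, 4, 3), (37, 3, 18, 10, 5)], [(29, 4, 14, 1, 8), (127, 3, 126,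
     55, 54), (43, 3, 42, 13, 26)], [(31, 3, 30, 26, 12), (71, 7, 70, 69, 8), (211,
     2, 210, 195, 127), (11, 2, 10, 7, 9), (631, 3, 630, 357, 475)], [(13, 2, 12, 7,
     9), (61, 2, 60, 35, 28), (181, 2, 180, 149, 60), (421, 2, 420, 84, 131)], [(109,
     6, 108, 90, 1), (379, 2, 378, 67, 358), (271, 6, 270, 250, 264), (757, 4, 378,
     202, 207), (1621, 8, 540, 138, 209)]]"];
    (simp only: evaluation_rules | simp))

lemma odd_unsolvable_724: "odd_unsolvable 724"
  by (rule odd_unsolvableI[of 724 1447 "[3, 5, 7, 2, 2, 2, 2, 3]"
    "[[(7, 3, 6, 1, 1), (13, 4, 6, 4, 5)], [(11, 2, 10, 6, 1), (31, 3, 30, 23, 1)],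
     [(43, 3, 42, 14, 37), (211, 2, 210, 73, 139), (421, 4, 210, 29, 115), (71, 7,
     70, 7, 62), (127, 5, 42, 17, 16)], [(5, 2, 4, 2, 3), (29, 2, 28, 14, 9), (61,
     2, 60, 33, 43)], [(41, 6, 40, 5, 13), (281, 3, 280, 208, 173)], [(17, 3, 16, 3,
     2), (113, 3, 112, 53, 82), (449, 4, 112, 30, 63), (337, 10, 336, 34, 209), (1201,
     41, 240, 203, 63)], [(193, 2, 96, 94, 49), (97, 20, 32, 9, 2), (673, 5, 672,
     223, 365)], [(19, 2, 18, 1, 5), (73, 5, 72, 50, 49), (631, 3, 630, 503, 569)]]"];
    (simp only: evaluation_rules | simp))

lemma odd_unsolvable_756: "odd_unsolvable 756"
  by (rule odd_unsolvableI[of 756 1511 "[3, 3, 2, 2, 2, 5, 7]"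
    "[[], [(19, 2, 18, 11, 1), (757, 84, 18, 9, 5)], [(13, 2, 12, 1, 8), (37, 2, 36,
     4, 27)], [(17, 2, 8, 3, 3), (73, 5, 72, 67, 45)], [(113, 40, 16, 5, 13)], [(11,
     2, 10, 3, 8), (41, 6, 40, 16, 19), (61, 2, 60, 9, 40), (181, 2, 180, 5, 53),
     (31, 3, 30, 19, 3)], [(29, 2, 28, 1, 23), (71, 7, 70, 21, 30), (43, 3, 42, 8,
     14), (127, 3, 126, 10, 95), (211, 32, 42, 12, 2), (631, 3, 630, 468, 593)]]"];
    (simp only: evaluation_rules | simp))

lemma odd_unsolvable_772: "odd_unsolvable 772"
  by (rule odd_unsolvableI[of 772 1543 "[3, 2, 5, 2, 3, 7]"
    "[[(7, 3, 6, 2, 5)], [(13, 2, 12, 9, 4)], [(31, 3, 30, 16, 17), (11, 2, 10, 1,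
     2), (61, 2, 60, 25, 47), (181, 6, 60, 20, 17)], [(97, 4, 24, 13, 17), (41, 6,
     40, 19, 23), (241, 3, 120, 91, 38)], [(19, 2, 18, 15, 16), (73, 5, 72, 47, 63),
     (37, 2, 36, 5, 24)], [(29, 2, 28, 11, 22), (211, 2, 210, 194, 4), (127, 5, 42,
     25, 28), (379, 8, 126, 52, 115)]]"];
    (simp only: evaluation_rules | simp))

lemma odd_unsolvable_780: "odd_unsolvable 780"
  by (rule odd_unsolvableI[of 780 1559 "[3, 5, 3, 2, 2, 7, 2]"
    "[[(7, 3, 6, 1, 1)], [(61, 4, 30, 5, 6), (11, 2, 10, 5, 7), (31, 3, 30, 20,
     28)], [(181, 4, 90, 9, 49)], [(109, 2, 36, 13, 9), (37, 2, 36, 26, 13), (541, 8,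
     180, 65, 88)], [(73, 5, 72, 10, 5), (401, 32, 40, 34, 35)], [(29, 2, 28, 19, 2),
     (71, 7, 70, 35, 9), (127, 3, 126, 74, 50), (281, 3, 280, 44, 201), (43, 3, 42,
     28, 12), (211, 8, 70, 37, 64), (421, 8, 140, 109, 72), (631, 3, 630, 334, 298)],
     [(17, 3, 16, 6, 3)]]"];
    (simp only: evaluation_rules | simp))

lemma odd_unsolvable_804: "odd_unsolvable 804"
  by (rule odd_unsolvableI[of 804 1607 "[2, 3]"
    "[[(5, 2, 4, 2, 3)], [(7, 3, 6, 3, 2), (61, 32, 12, 3, 1)]]"];
    (simp only: evaluation_rules | simp))

lemma odd_unsolvable_892: "odd_unsolvable 892"
  by (rule odd_unsolvableI[of 892 1783 "[3, 3, 5, 2, 2, 3, 7, 2]"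
    "[[(7, 3, 6, 1, 1)], [(37, 3, 18, 7, 14), (19, 2, 18, 9, 14)], [(31, 3, 30, 13,
     24), (181, 4, 90, 37, 51)], [(61, 2, 60, 27, 10), (41, 2, 20, 18, 11), (13, 2,
     12, 3, 11)], [(17, 2, 8, 3, 3), (241, 3, 120, 77, 94), (73, 5, 72, 32, 61)],
     [(109, 6, 108, 82, 97), (433, 48, 54, 46, 34), (271, 6, 270, 96, 125), (541, 2,
     540, 445, 39)], [(29, 2, 28, 26, 15), (43, 3, 42, 9, 5), (211, 2, 210, 47, 134),
     (281, 3, 280, 84, 171), (127, 3, 126, 1, 39), (379, 2, 378, 265, 30), (421, 2,
     420, 137, 76), (757, 2, 756, 391, 561), (71, 7, 70, 46, 52)], [(113, 3, 112, 81,
     2), (337, 10, 336, 159, 68)]]"];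
    (simp only: evaluation_rules | simp))

lemma odd_unsolvable_916: "odd_unsolvable 916"
  by (rule odd_unsolvableI[of 916 1831 "[2, 2, 3, 2, 7, 3, 5]"
    "[[], [(41, 3, 8, 7, 5)], [(13, 2, 12, 5, 5), (7, 3, 6, 3, 2)], [(17, 3, 16, 6,
     3), (97, 2, 48, 34, 3)], [(43, 3, 42, 32, 34), (113, 3, 112, 25, 71), (29, 2,
     28, 21, 26), (449, 4, 112, 64, 35)], [(19, 2, 18, 2, 12), (37, 2, 36, 34, 19),
     (127, 3, 126, 3, 19), (73, 5, 72, 25, 58), (2017, 3, 1008, 942, 395)], [(11, 2,
     10, 8, 6), (31, 3, 30, 7, 6), (71, 7, 70, 36, 51), (241, 3, 120, 81, 98), (211,
     2, 210, 89, 114), (281, 3, 280, 125, 202)]]"];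
    (simp only: evaluation_rules | simp))

lemma odd_unsolvable_924: "odd_unsolvable 924"
  by (rule odd_unsolvableI[of 924 1847 "[2, 3, 5, 3, 2, 7, 3, 2]"
    "[[(5, 2, 4, 2, 3)], [], [(61, 2, 60, 12, 13), (31, 3, 30, 10, 4), (241, 9, 60,
     57, 28)], [(37, 3, 18, 9, 8), (19, 2, 18, 15, 16), (181, 2, 180, 135, 154)],
     [(73, 5, 72, 38, 9), (41, 6, 40, 29, 14)], [(421, 4, 210, 154, 58), (211, 2,
     210, 136, 169), (43, 2, 14, 6, 6), (281, 3, 280, 4, 181), (127, 3, 126, 76, 4),
     (631, 3, 630, 165, 491), (29, 4, 14, 8, 2)], [(109, 6, 108, 73, 53), (379, 2,
     378, 133, 48), (541, 2, 540, 119, 277), (271, 6, 270, 265, 181), (757, 2, 756,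
     302, 655)], [(17, 3, 16, 15, 9), (113, 3, 112, 107, 89)]]"];
    (simp only: evaluation_rules | simp))

lemma odd_unsolvable_940: "odd_unsolvable 940"
  by (rule odd_unsolvableI[of 940 1879 "[3, 2, 3, 5, 7, 2]"
    "[[(7, 3, 6, 2, 5)], [(13, 2, 12, 2, 1)], [(37, 2, 36, 13, 15), (19, 2, 18, 8,
     8), (73, 6, 36, 24, 29)], [(61, 4, 30, 22, 11), (11, 2, 10, 4, 4), (31, 3, 30,
     14, 26), (181, 2, 180, 171, 71)], [(127, 3, 126, 39, 23), (29, 2, 28, 7, 8),
     (71, 7, 70, 49, 13), (43, 3, 42, 7, 31), (211, 2, 210, 48, 181), (421, 2, 420,
     313, 95)], [(41, 6, 40, 35, 21), (241, 3, 120, 76, 89), (281, 3, 280, 109, 115)]]"];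
    (simp only: evaluation_rules | simp))


section \<open>Which of the numbers 2k - 1 can be prime powers\<close>

lemma prime_dvd_divisor_of_power:
  fixes p c :: int
  assumes "prime p" "1 < c" "c dvd p ^ n"
  shows "p dvd c"
proof -
  obtain r where r: "prime r" "r dvd c" using prime_divisor_exists[of c] assms by auto
  then have "r dvd p" using assms prime_dvd_power dvd_trans by blast
  then show ?thesis using r assms(1) primes_dvd_imp_eq by blast
qed

text \<open>The prime behind the power would divide both factors, hence also a u - b v = 1.\<close>

lemma not_primepow_coprime:
  fixes a b :: int
  assumes "1 < a" "1 < b" "a * u - b * v = 1"
  shows "\<not> primepow (a * b)"
proof
  assume "primepow (a * b)"
  then obtain p n where p: "prime p" and ab: "a * b = p ^ n" by (auto simp: primepow_def)
  have "p dvd a" "p dvd b"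
    using prime_dvd_divisor_of_power[OF p] assms ab dvd_triv_left[of a b] dvd_triv_right[of b a] by auto
  then have "p dvd a * u - b * v" by (simp add: dvd_diff)
  then show False using assms p by (simp add: not_prime_unit)
qed

text \<open>Each entry \<open>(a, b, u, v)\<close> satisfies \<open>a u - b v = 1\<close>, so \<open>a\<close> and \<open>b\<close> are coprime.\<close>

definition coprime_factorizations :: "(int \<times> int \<times> int \<times> int) list" where
  "coprime_factorizations =
   [(3, 13, 9, 2), (5, 11, 9, 4), (3, 29, 10, 1), (7, 17, 5, 2), (27, 5, 3, 16), (3, 61, 41,
    2), (5, 43, 26, 3), (3, 77, 26, 1), (13, 19, 3, 2), (9, 31, 7, 2), (5, 59, 12, 1), (3, 109,
    73, 2), (3, 125, 42, 1), (17, 23, 19, 14), (11, 37, 27, 8), (9, 47, 21, 4), (5, 91, 73, 4),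
    (3, 157, 105, 2), (3, 173, 58, 1), (5, 107, 43, 2), (19, 29, 26, 17), (81, 7, 2, 23), (11,
    53, 29, 6), (3, 205, 137, 2), (3, 221, 74, 1), (7, 97, 14, 1), (5, 139, 28, 1), (9, 79, 44,
    5), (3, 253, 169, 2), (25, 31, 5, 4), (7, 113, 97, 6), (3, 269, 90, 1), (9, 95, 74, 7), (13,
    67, 31, 6), (3, 301, 201, 2), (5, 187, 75, 2), (3, 317, 106, 1), (27, 37, 11, 8), (5, 203,
    122, 3), (3, 349, 233, 2), (13, 83, 32, 5), (3, 365, 122, 1), (11, 101, 46, 5), (49, 23, 8,
    17), (9, 127, 113, 8), (19, 61, 45, 14), (25, 47, 32, 17), (3, 397, 265, 2), (17, 71, 46,
    11), (3, 413, 138, 1), (5, 251, 201, 4), (31, 41, 4, 3), (9, 143, 16, 1), (3, 445, 297, 2),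
    (7, 193, 138, 5), (3, 461, 154, 1), (5, 283, 170, 3), (27, 53, 2, 1), (7, 209, 30, 1), (3,
    493, 329, 2), (5, 299, 60, 1), (3, 509, 170, 1), (9, 175, 39, 2), (37, 43, 7, 6), (3, 541,
    361, 2), (11, 149, 122, 9), (5, 331, 265, 4), (3, 557, 186, 1), (7, 241, 69, 2), (13, 131,
    121, 12), (9, 191, 85, 4), (5, 347, 139, 2), (17, 103, 97, 16), (3, 589, 393, 2), (7, 257,
    147, 4), (3, 605, 202, 1), (81, 23, 2, 7), (5, 379, 76, 1), (3, 637, 425, 2), (41, 47, 39,
    34), (29, 67, 37, 16), (3, 653, 218, 1), (25, 79, 19, 6), (11, 181, 33, 2)]"

lemma not_primepow_coprime_factorizations:
  "(a, b, u, v) \<in> set coprime_factorizations \<Longrightarrow> \<not> primepow (a * b)"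
proof -
  have "list_all (\<lambda>(a, b, u, v). 1 < a \<and> 1 < b \<and> a * u - b * v = 1) coprime_factorizations"
    by (simp add: coprime_factorizations_def)
  then show "(a, b, u, v) \<in> set coprime_factorizations \<Longrightarrow> \<not> primepow (a * b)"
    using not_primepow_coprime by (fastforce simp: list_all_iff)
qed

text \<open>k = 8i + 4 leaves 125 numbers 2k - 1 = 16i + 7. For k outside the list a recorded
  coprime factorization refutes the prime power, in place of a primality test.\<close>

lemma primepow_cases:
  assumes "4 \<le> k" "k \<le> 1000" "4 dvd k" "\<not> 8 dvd k" "primepow (2 * k - 1 :: int)"
  shows "k \<in> {4, 12, 36, 52, 76, 84, 100, 132, 156, 172, 180, 220, 244, 252, 300, 316, 324, 364, 372,
    412, 420, 444, 460, 484, 492, 516, 532, 612, 652, 660, 684, 700, 724, 756, 772, 780, 804,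
    892, 916, 924, 940}"
proof -
  have "\<exists>i. k = 8 * i + 4" using assms(3,4) by presburger
  then obtain i where i: "k = 8 * i + 4" ..
  have "list_all (\<lambda>i. 16 * i + 7 \<in> set (map (\<lambda>(a, b, u, v). a * b) coprime_factorizations) \<or>
      8 * i + 4 \<in> {4, 12, 36, 52, 76, 84, 100, 132, 156, 172, 180, 220, 244, 252, 300, 316, 324, 364, 372,
    412, 420, 444, 460, 484, 492, 516, 532, 612, 652, 660, 684, 700, 724, 756, 772, 780, 804,
    892, 916, 924, 940}) [0..124]"
    by code_simp
  moreover have "i \<in> set [0..124]" using assms(1,2) i by simp
  ultimately have "16 * i + 7 \<in> set (map (\<lambda>(a, b, u, v). a * b) coprime_factorizations) \<or>
      8 * i + 4 \<in> {4, 12, 36, 52, 76, 84, 100, 132, 156, 172, 180, 220, 244, 252, 300, 316, 324, 364, 372,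
    412, 420, 444, 460, 484, 492, 516, 532, 612, 652, 660, 684, 700, 724, 756, 772, 780, 804,
    892, 916, 924, 940}"
    unfolding list_all_iff by blast
  moreover have "primepow (16 * i + 7)" using assms(5) i by (simp add: add.commute)
  then have "16 * i + 7 \<notin> set (map (\<lambda>(a, b, u, v). a * b) coprime_factorizations)"
    using not_primepow_coprime_factorizations by auto
  ultimately show ?thesis unfolding i by blast
qed

lemma prime_power_difference_of_squares:
  fixes a x p :: int
  assumes p: "prime p" and "\<not> p dvd 2 * a" "a > 0" "x > 0" and eq: "x\<^sup>2 + p ^ n = a\<^sup>2"
  shows "a - x = 1"
proof (rule ccontr)
  assume "a - x \<noteq> 1"
  have prod: "(a - x) * (a + x) = p ^ n"
    using eq by (simp add: power2_eq_square algebra_simps)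
  have "0 < (a - x) * (a + x)" unfolding prod using p by (simp add: prime_gt_0_int)
  then have "a - x > 0" using assms(3,4) by (simp add: zero_less_mult_iff)
  then have "a - x > 1" "a + x > 1" using \<open>a - x \<noteq> 1\<close> assms(3,4) by linarith+
  moreover have "a - x dvd p ^ n" "a + x dvd p ^ n" unfolding prod[symmetric] by simp_all
  ultimately have "p dvd a - x" "p dvd a + x" using prime_dvd_divisor_of_power[OF p] by blast+
  then have "p dvd (a - x) + (a + x)" by (rule dvd_add)
  then show False using assms(2) by simp
qed

lemma odd_unsolvable_int:
  fixes x k :: int
  assumes "odd_unsolvable (nat k)" "k > 0" "odd y" "odd z"
  shows "x\<^sup>2 + (2 * k - 1) ^ y \<noteq> k ^ z"
proof
  assume eq: "x\<^sup>2 + (2 * k - 1) ^ y = k ^ z"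
  obtain Y Z where yz: "y = 2 * Y + 1" "z = 2 * Z + 1" using assms(3,4) by (elim oddE)
  define n where "n = nat k"
  have n: "n > 0" "k = int n" "2 * k - 1 = int (2 * n - 1)" using assms(2) by (auto simp: n_def)
  have "int ((nat \<bar>x\<bar>)\<^sup>2 + (2 * n - 1) ^ y) = int (n ^ z)"
    using eq unfolding of_nat_add of_nat_power n(3)[symmetric] n(2)[symmetric] by simp
  then have "(nat \<bar>x\<bar>)\<^sup>2 + (2 * n - 1) ^ y = n ^ z" by (simp only: of_nat_eq_iff)
  then show False using assms(1) unfolding odd_unsolvable_def yz n_def[symmetric] by blast
qed

text \<open>Since 7^2 = 49 leaves remainder 1 modulo 16, the powers of q alternate between 1 and
  7.\<close>

lemma seven_mod_16_power:
  fixes q :: int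
  assumes "q mod 16 = 7"
  shows "even y \<Longrightarrow> q ^ y mod 8 = 1" "odd y \<Longrightarrow> q ^ y mod 16 = 7"
proof -
  have "[q\<^sup>2 = 7\<^sup>2] (mod 16)" using assms by (intro cong_pow) (simp add: cong_def)
  then have sq: "[q\<^sup>2 = 1] (mod 16)" by (simp add: cong_def)
  have e: "[q ^ (2 * n) = 1] (mod 16)" for n
    using cong_pow[OF sq, of n] by (simp add: power_mult)
  show "q ^ y mod 8 = 1" if "even y"
  proof -
    obtain n where "y = 2 * n" using \<open>even y\<close> by (elim evenE)
    then have "[q ^ y = 1] (mod 8)" using e[of n] cong_dvd_modulus[of "q ^ y" 1 16 8] by simp
    then show ?thesis by (simp add: cong_def)
  qed
  show "q ^ y mod 16 = 7" if "odd y"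
  proof -
    obtain n where "y = 2 * n + 1" using \<open>odd y\<close> by (elim oddE)
    then have "[q ^ y = 1 * 7] (mod 16)"
      using cong_mult[OF e[of n], of q 7] assms by (simp add: cong_def mult.commute)
    then show ?thesis by (simp add: cong_def)
  qed
qed

lemma square_mod_8: "(x :: int)\<^sup>2 mod 8 \<in> {0, 1, 4}"
proof -
  have "x mod 8 \<in> {0, 1, 2, 3, 4, 5, 6, 7}" by auto
  then have "(x mod 8)\<^sup>2 mod 8 \<in> {0, 1, 4}" by auto
  then show ?thesis by (simp add: power_mod)
qed

theorem theorem1p3:
  fixes k :: int
  assumes "4 \<le> k" and "k \<le> 1000"
    and "4 dvd k" and "\<not> 8 dvd k"
    and "primepow (2 * k - 1)"
  shows "\<forall>(x::int) (y::nat) (z::nat).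
    (x > 0 \<and> y > 0 \<and> z > 0 \<and> x ^ 2 + (2 * k - 1) ^ y = k ^ z) \<longleftrightarrow>
    (x = k - 1 \<and> y = 1 \<and> z = 2)"
proof -
  define q where "q = 2 * k - 1"
  have q16: "q mod 16 = 7" and q1: "q > 1"
    using assms(1-4) unfolding q_def by presburger+
  obtain p e where p: "prime p" and q: "q = p ^ e" and e: "e > 0"
    using assms(5) unfolding q_def primepow_def by auto
  have pq: "p dvd q" using q e by (simp add: dvd_power)
  \<comment> \<open>p divides neither 2, as q is odd, nor k, as 2k - q = 1.\<close>
  have pk: "\<not> p dvd 2 * a" if "a dvd k ^ n" for a n
  proof
    assume "p dvd 2 * a"
    moreover have "\<not> p dvd 2"
    proof
      assume "p dvd 2"
      then have "p = 2" using primes_dvd_imp_eq[OF p, of 2] by simp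
      then show False using pq q16 by presburger
    qed
    ultimately have "p dvd k ^ n" using p that by (meson dvd_trans prime_dvd_mult_iff)
    then have "p dvd k" by (rule prime_dvd_power[OF p])
    then have "p dvd 2 * k - q" by (intro dvd_diff dvd_mult pq)
    then have "is_unit p" by (simp add: q_def)
    then show False using p not_prime_unit by blast
  qed
  have main: "x = k - 1 \<and> y = 1 \<and> z = 2"
    if x: "x > 0" and y: "y > 0" and z: "z > 0" and eq: "x\<^sup>2 + q ^ y = k ^ z" for x y z
  proof -
    \<comment> \<open>Already q = 2k - 1 exceeds k.\<close>
    have "z \<noteq> 1"
    proof
      assume "z = 1"
      have "q ^ 1 \<le> q ^ y" using y q1 by (intro power_increasing) auto
      then show False using eq x assms(1) \<open>z = 1\<close> zero_less_power[OF x, of 2] by (simp add: q_def)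
    qed
    then have z2: "z \<ge> 2" using z by simp
    have "(k ^ z) mod 8 = 0"
    proof -
      have "(4::int) ^ 2 dvd k ^ 2" using assms(3) by (rule dvd_power_same)
      then have "(8::int) dvd k ^ 2" by (rule dvd_trans[rotated]) simp
      then show ?thesis using le_imp_power_dvd[OF z2, of k] dvd_trans by (metis dvd_eq_mod_eq_0)
    qed
    then have "(x\<^sup>2 + q ^ y) mod 8 = 0" using eq by simp
    \<comment> \<open>An even y would give x^2 = -1 modulo 8.\<close>
    then have oy: "odd y"
      using square_mod_8[of x] seven_mod_16_power(1)[OF q16, of y] by auto presburger+
    \<comment> \<open>Stated for any root \<open>a\<close> of k^z because it is applied twice: to
      s^z when k = s^2 and z is odd, and to k^w when z = 2w.\<close>
    have factor: "a - x = 1 \<and> 2 * a = q ^ y + 1 \<and> \<not> 8 dvd a" if a: "a > 0" "a\<^sup>2 = k ^ z" for a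
    proof -
      have "a - x = 1"
      proof (rule prime_power_difference_of_squares[OF p pk a(1) x])
        show "a dvd k ^ z" using a(2) by (metis dvd_triv_left power2_eq_square)
        show "x\<^sup>2 + p ^ (e * y) = a\<^sup>2" using eq a(2) q by (simp add: power_mult)
      qed
      moreover have "(a - x) * (a + x) = q ^ y"
        using eq a(2) by (simp add: power2_eq_square algebra_simps)
      ultimately have "2 * a = q ^ y + 1" by simp
      moreover have "q ^ y mod 16 = 7" using seven_mod_16_power(2)[OF q16 oy] .
      ultimately show ?thesis using \<open>a - x = 1\<close> by presburger
    qed
    have "even z"
    proof (rule ccontr)
      assume oz: "odd z"
      have "k \<in> {4, 12, 36, 52, 76, 84, 100, 132, 156, 172, 180, 220, 244, 252, 300, 316, 324, 364, 372,
    412, 420, 444, 460, 484, 492, 516, 532, 612, 652, 660, 684, 700, 724, 756, 772, 780, 804,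
    892, 916, 924, 940}"
        using assms by (rule primepow_cases)
      \<comment> \<open>Five of the 41 values are squares of even numbers: 4, 36, 100, 324 and
        484.\<close>
      then have "(\<exists>s. s > 0 \<and> even s \<and> s\<^sup>2 = k) \<or> odd_unsolvable (nat k)"
      proof (elim insertE emptyE)
        assume "k = 4"
        then show ?thesis by (intro disjI1 exI[of _ 2]) simp
      next
        assume "k = 12"
        then show ?thesis using odd_unsolvable_12 by simp
      next
        assume "k = 36"
        then show ?thesis by (intro disjI1 exI[of _ 6]) simp
      next
        assume "k = 52"
        then show ?thesis using odd_unsolvable_52 by simp
      next
        assume "k = 76"
        then show ?thesis using odd_unsolvable_76 by simp
      next
        assume "k = 84"
        then show ?thesis using odd_unsolvable_84 by simp
      next
        assume "k = 100"
        then show ?thesis by (intro disjI1 exI[of _ 10]) simp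
      next
        assume "k = 132"
        then show ?thesis using odd_unsolvable_132 by simp
      next
        assume "k = 156"
        then show ?thesis using odd_unsolvable_156 by simp
      next
        assume "k = 172"
        then show ?thesis using odd_unsolvable_172 by simp
      next
        assume "k = 180"
        then show ?thesis using odd_unsolvable_180 by simp
      next
        assume "k = 220"
        then show ?thesis using odd_unsolvable_220 by simp
      next
        assume "k = 244"
        then show ?thesis using odd_unsolvable_244 by simp
      next
        assume "k = 252"
        then show ?thesis using odd_unsolvable_252 by simp
      next
        assume "k = 300"
        then show ?thesis using odd_unsolvable_300 by simp
      next
        assume "k = 316"
        then show ?thesis using odd_unsolvable_316 by simp
      next
        assume "k = 324"
        then show ?thesis by (intro disjI1 exI[of _ 18]) simp
      next
        assume "k = 364"
        then show ?thesis using odd_unsolvable_364 by simp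
      next
        assume "k = 372"
        then show ?thesis using odd_unsolvable_372 by simp
      next
        assume "k = 412"
        then show ?thesis using odd_unsolvable_412 by simp
      next
        assume "k = 420"
        then show ?thesis using odd_unsolvable_420 by simp
      next
        assume "k = 444"
        then show ?thesis using odd_unsolvable_444 by simp
      next
        assume "k = 460"
        then show ?thesis using odd_unsolvable_460 by simp
      next
        assume "k = 484"
        then show ?thesis by (intro disjI1 exI[of _ 22]) simp
      next
        assume "k = 492"
        then show ?thesis using odd_unsolvable_492 by simp
      next
        assume "k = 516"
        then show ?thesis using odd_unsolvable_516 by simp
      next
        assume "k = 532"
        then show ?thesis using odd_unsolvable_532 by simp
      next
        assume "k = 612"
        then show ?thesis using odd_unsolvable_612 by simp
      next
        assume "k = 652"
        then show ?thesis using odd_unsolvable_652 by simp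
      next
        assume "k = 660"
        then show ?thesis using odd_unsolvable_660 by simp
      next
        assume "k = 684"
        then show ?thesis using odd_unsolvable_684 by simp
      next
        assume "k = 700"
        then show ?thesis using odd_unsolvable_700 by simp
      next
        assume "k = 724"
        then show ?thesis using odd_unsolvable_724 by simp
      next
        assume "k = 756"
        then show ?thesis using odd_unsolvable_756 by simp
      next
        assume "k = 772"
        then show ?thesis using odd_unsolvable_772 by simp
      next
        assume "k = 780"
        then show ?thesis using odd_unsolvable_780 by simp
      next
        assume "k = 804"
        then show ?thesis using odd_unsolvable_804 by simp
      next
        assume "k = 892"
        then show ?thesis using odd_unsolvable_892 by simp
      next
        assume "k = 916"
        then show ?thesis using odd_unsolvable_916 by simp
      next
        assume "k = 924"
        then show ?thesis using odd_unsolvable_924 by simp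
      next
        assume "k = 940"
        then show ?thesis using odd_unsolvable_940 by simp
      qed
      then show False
      proof
        assume "\<exists>s. s > 0 \<and> even s \<and> s\<^sup>2 = k"
        then obtain s where s: "s > 0" "even s" "s\<^sup>2 = k" by blast
        have "(s ^ z)\<^sup>2 = k ^ z" unfolding s(3)[symmetric] power_mult[symmetric] by (simp only: mult.commute)
        then have "\<not> 8 dvd s ^ z" using factor[of "s ^ z"] s(1) by simp
        moreover have "z \<ge> 3" using oz z2 by (cases "z = 2") auto
        then have "2 ^ 3 dvd s ^ z" using s(2) dvd_power_same le_imp_power_dvd dvd_trans by meson
        ultimately show False by simp
      next
        assume "odd_unsolvable (nat k)"
        then show False using odd_unsolvable_int eq oy oz assms(1) unfolding q_def by auto
      qed
    qed
    then obtain w where w: "z = 2 * w" by (elim evenE)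
    have "k ^ w > 0" "(k ^ w)\<^sup>2 = k ^ z" using assms(1) by (simp_all add: w power_even_eq)
    note f = factor[OF this]
    have "w = 1"
    proof (rule ccontr)
      assume "w \<noteq> 1"
      then have "w \<ge> 2" using z w by simp
      then have "4 ^ 2 dvd k ^ w" using assms(3) dvd_power_same le_imp_power_dvd dvd_trans by meson
      then have "8 dvd k ^ w" by (rule dvd_trans[rotated]) simp
      then show False using f by simp
    qed
    \<comment> \<open>For w = 1 the root is k itself, and 2k = q^y + 1 reads q^y = q.\<close>
    moreover from this f have "q ^ y = q ^ 1" by (simp add: q_def)
    then have "y = 1" using q1 power_inject_exp by blast
    ultimately show ?thesis using f w by simp
  qed
  show ?thesis
  proof (intro allI iffI)
    fix x :: int and y z :: nat
    assume "x = k - 1 \<and> y = 1 \<and> z = 2"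
    then have "x = k - 1" "y = 1" "z = 2" by blast+
    moreover have "(k - 1)\<^sup>2 + (2 * k - 1) = k\<^sup>2" by (simp add: power2_eq_square algebra_simps)
    ultimately show "x > 0 \<and> y > 0 \<and> z > 0 \<and> x ^ 2 + (2 * k - 1) ^ y = k ^ z"
      using assms(1) by simp
  qed (use main in \<open>auto simp: q_def\<close>)
qed

end
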